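(* If $\operatorname{cof}(\mathcal{M})=\omega_1$, then the Cantor cube $2^{\omega_1}$ has a countable dense subspace which is not $NWD$-separable. Consequently $\mathfrak{cds}=\omega_1$.
   Context: $\operatorname{cof}(\mathcal{M})$ is the cofinality of the ideal of meager subsets of the real line. A space $X$ is $NWD$-separable if for every sequence $\{D_n:n<\omega\}$ of dense subsets of $X$ there are nowhere dense sets $E_n\subseteq D_n$ with $\bigcup_{n<\omega}E_n$ dense; it is $D$-separable if the same holds with discrete sets $E_n$. $\mathfrak{cds}=\min\{\kappa:2^\kappa\text{ contains a countable non-}D\text{-separable subspace}\}$. *)

theory Defs
  imports "HOL-Analysis.Analysis"
begin

abbreviation omega1 :: "nat set rel" where
  "omega1 \<equiv> cardSuc natLeq"

definition nowhere_dense_in :: "'a topology \<Rightarrow> 'a set \<Rightarrow> bool" where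
  "nowhere_dense_in X A \<longleftrightarrow> A \<subseteq> topspace X \<and> X interior_of (X closure_of A) = {}"

definition dense_in :: "'a topology \<Rightarrow> 'a set \<Rightarrow> bool" where
  "dense_in X D \<longleftrightarrow> D \<subseteq> topspace X \<and> X closure_of D = topspace X"

definition discrete_in :: "'a topology \<Rightarrow> 'a set \<Rightarrow> bool" where
  "discrete_in X E \<longleftrightarrow> E \<subseteq> topspace X \<and> subtopology X E = discrete_topology E"

definition NWD_separable :: "'a topology \<Rightarrow> bool" where
  "NWD_separable X \<longleftrightarrow>
     (\<forall>D :: nat \<Rightarrow> 'a set. (\<forall>n. dense_in X (D n)) \<longrightarrow>
        (\<exists>E. (\<forall>n. E n \<subseteq> D n \<and> nowhere_dense_in X (E n)) \<and> dense_in X (\<Union>n. E n)))"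

definition D_separable :: "'a topology \<Rightarrow> bool" where
  "D_separable X \<longleftrightarrow>
     (\<forall>D :: nat \<Rightarrow> 'a set. (\<forall>n. dense_in X (D n)) \<longrightarrow>
        (\<exists>E. (\<forall>n. E n \<subseteq> D n \<and> discrete_in X (E n)) \<and> dense_in X (\<Union>n. E n)))"

definition cantor_cube :: "'i set \<Rightarrow> ('i \<Rightarrow> bool) topology" where
  "cantor_cube I = product_topology (\<lambda>i. discrete_topology (UNIV :: bool set)) I"

definition meager :: "real set \<Rightarrow> bool" where
  "meager A \<longleftrightarrow> (\<exists>N :: nat \<Rightarrow> real set. (\<forall>n. nowhere_dense_in euclidean (N n)) \<and> A \<subseteq> (\<Union>n. N n))"

definition meager_cofinal :: "real set set \<Rightarrow> bool" where
  "meager_cofinal F \<longleftrightarrow> (\<forall>B\<in>F. meager B) \<and> (\<forall>A. meager A \<longrightarrow> (\<exists>B\<in>F. A \<subseteq> B))"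

definition cof_meager_eq_omega1 :: bool where
  "cof_meager_eq_omega1 \<longleftrightarrow>
     (\<exists>F. meager_cofinal F \<and> ordIso2 (card_of F) omega1) \<and>
     (\<forall>F. meager_cofinal F \<longrightarrow> ordLeq3 omega1 (card_of F))"

definition has_countable_nonD_subspace :: "'i set \<Rightarrow> bool" where
  "has_countable_nonD_subspace I \<longleftrightarrow>
     (\<exists>S. S \<subseteq> topspace (cantor_cube I) \<and> countable S \<and>
          \<not> D_separable (subtopology (cantor_cube I) S))"

text \<open>cds = omega_1: cardinals are represented by index sets of type nat set set,
  which realise every cardinal up to 2^continuum (in particular all cardinals at most omega_1).\<close>
definition cds_eq_omega1 :: bool where
  "cds_eq_omega1 \<longleftrightarrow>
     (\<exists>I :: nat set set. ordIso2 (card_of I) omega1 \<and> has_countable_nonD_subspace I) \<and>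
     (\<forall>I :: nat set set. has_countable_nonD_subspace I \<longrightarrow> ordLeq3 omega1 (card_of I))"

end

theory Submission
  imports Defs "HOL-Library.Countable_Set_Type"
begin

text \<open>
  From a cofinal family of \<open>\<omega>\<^sub>1\<close> meager sets one reads off \<open>\<omega>\<^sub>1\<close> pairs \<open>(x', j')\<close>, each cutting
  \<open>\<nat>\<close> into the blocks \<open>[j' k, j' (k + 1))\<close>, such that for every sequence \<open>E\<^sub>n\<close> of nowhere dense subsets
  of \<open>2\<^sup>\<omega>\<close> one of the pairs has the property that no \<open>y \<in> E\<^sub>n\<close> agrees with \<open>x'\<close> on a block of index
  \<open>k \<ge> n\<close> (this is Fremlin's \<open>cof(nwd) = cof(M)\<close>, in a form uniform for sequences).

  The coordinates \<open>f\<^sub>\<beta>\<close> (\<open>\<beta> < \<omega>\<^sub>1\<close>) of the points of the countable set \<open>\<Union>\<^sub>n D\<^sub>n\<close>, where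
  \<open>D\<^sub>n = {n} \<times> \<nat>\<close>, are chosen by recursion.  Stage \<open>\<beta>\<close> takes one pair, read along an enumeration of an
  initial segment \<open>\<alpha> \<le> \<beta>\<close>, and lets \<open>f\<^sub>\<beta>\<close> be true only at points of \<open>D\<^sub>n\<close> that agree with \<open>x'\<close> on
  some block of index \<open>k \<ge> n\<close>, keeping the coordinates independent on every \<open>D\<^sub>n\<close>.  A sequence of
  nowhere dense sets \<open>E\<^sub>n \<subseteq> D\<^sub>n\<close> is already nowhere dense with respect to countably many coordinates,
  so at some stage \<open>\<beta>\<close> the open set \<open>{z. z \<beta>}\<close> is made disjoint from \<open>\<Union>\<^sub>n E\<^sub>n\<close>.
\<close>

section \<open>Nowhere dense subsets of the Cantor space\<close>

definition agree_on :: "'i set \<Rightarrow> ('i \<Rightarrow> 'b) \<Rightarrow> ('i \<Rightarrow> 'b) \<Rightarrow> bool" where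
  "agree_on F y z \<longleftrightarrow> (\<forall>i\<in>F. y i = z i)"

lemma agree_on_empty [simp]: "agree_on {} y z"
  by (simp add: agree_on_def)

lemma agree_on_refl [simp]: "agree_on F z z"
  by (simp add: agree_on_def)

lemma agree_on_subset: "agree_on G y z \<Longrightarrow> F \<subseteq> G \<Longrightarrow> agree_on F y z"
  by (auto simp: agree_on_def)

text \<open>Nowhere density of the trace of \<open>E\<close> on \<open>2^C\<close>, tested on basic
  clopen sets: \<open>p\<close> on \<open>F\<close> is a condition, \<open>q\<close> on
  \<open>G\<close> an extension of it that no point of \<open>E\<close> satisfies. Values off
  \<open>C\<close> never matter, so one set \<open>E\<close> can be tested against different
  \<open>C\<close>.\<close>

definition cyl_nowhere_dense :: "'i set \<Rightarrow> ('i \<Rightarrow> bool) set \<Rightarrow> bool" where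
  "cyl_nowhere_dense C E \<longleftrightarrow>
     (\<forall>F p. finite F \<and> F \<subseteq> C \<longrightarrow>
        (\<exists>G q. finite G \<and> F \<subseteq> G \<and> G \<subseteq> C \<and> agree_on F q p \<and> (\<forall>z\<in>E. \<not> agree_on G z q)))"

lemma cyl_nowhere_denseD:
  assumes "cyl_nowhere_dense C E" "finite F" "F \<subseteq> C"
  shows "\<exists>G q. finite G \<and> F \<subseteq> G \<and> G \<subseteq> C \<and> agree_on F q p \<and> (\<forall>z\<in>E. \<not> agree_on G z q)"
  using assms unfolding cyl_nowhere_dense_def by auto

lemma cyl_nowhere_dense_empty: "cyl_nowhere_dense C {}"
  unfolding cyl_nowhere_dense_def
proof (intro allI impI)
  fix F :: "'a set" and p :: "'a \<Rightarrow> bool"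
  assume F: "finite F \<and> F \<subseteq> C"
  show "\<exists>G q. finite G \<and> F \<subseteq> G \<and> G \<subseteq> C \<and> agree_on F q p \<and> (\<forall>z\<in>{}. \<not> agree_on G z q)"
    by (rule exI[of _ F], rule exI[of _ p]) (use F in simp)
qed

text \<open>
  The same segment \<open>w\<close> has to work for all prefixes \<open>T\<close> at once, which is what makes
  \<open>block_avoid\<close> independent of the values below \<open>a\<close>.
\<close>

lemma finite_prefixes_avoid:
  fixes E :: "'k \<Rightarrow> (nat \<Rightarrow> bool) set"
  assumes "finite Q" "\<And>T n. (T, n) \<in> Q \<Longrightarrow> cyl_nowhere_dense UNIV (E n)"
  shows "\<exists>b\<ge>a. \<exists>w. \<forall>(T, n)\<in>Q. \<forall>y\<in>E n.
           agree_on {..<a} y (\<lambda>i. i \<in> T) \<longrightarrow> \<not> agree_on {a..<b} y w"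
  using assms
proof (induction Q rule: finite_induct)
  case empty
  then show ?case by auto
next
  case (insert t Q)
  obtain T n where t: "t = (T, n)" by force
  from insert obtain b w where b: "b \<ge> a" and
    w: "\<And>T n y. (T, n) \<in> Q \<Longrightarrow> y \<in> E n \<Longrightarrow> agree_on {..<a} y (\<lambda>i. i \<in> T)
           \<Longrightarrow> \<not> agree_on {a..<b} y w"
    by force
  \<comment> \<open>The condition to be extended contains \<open>w\<close> on
    \<open>{a..<b}\<close>, so \<open>q\<close> prolongs \<open>w\<close> and the pairs already
    treated stay avoided.\<close>
  obtain G q where G: "finite G" "{..<b} \<subseteq> G"
    and q: "agree_on {..<b} q (\<lambda>i. if i < a then i \<in> T else w i)"
    and E: "\<And>y. y \<in> E n \<Longrightarrow> \<not> agree_on G y q"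
    using cyl_nowhere_denseD[of UNIV "E n" "{..<b}" "\<lambda>i. if i < a then i \<in> T else w i"]
      insert.prems[of T n] t
    by auto
  \<comment> \<open>The inserted 0 keeps \<open>Max\<close> meaningful when \<open>G\<close> is
    empty.\<close>
  define b' where "b' = max b (Suc (Max (insert 0 G)))"
  have G_b': "G \<subseteq> {..<b'}"
  proof
    fix i assume "i \<in> G"
    then have "i \<le> Max (insert 0 G)" using G by simp
    then show "i \<in> {..<b'}" by (simp add: b'_def)
  qed
  have qw: "agree_on {a..<b} q w"
    using q by (auto simp: agree_on_def)
  have "\<not> agree_on {a..<b'} y q"
    if "(T', n') \<in> insert t Q" "y \<in> E n'" "agree_on {..<a} y (\<lambda>i. i \<in> T')" for T' n' y
  proof
    assume *: "agree_on {a..<b'} y q"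
    show False
    proof (cases "(T', n') \<in> Q")
      case True
      have "agree_on {a..<b} y w"
        using * qw b by (auto simp: agree_on_def b'_def)
      with w[OF True that(2,3)] show False by blast
    next
      case False
      then have eq: "T' = T" "n' = n" using that t by auto
      have "y i = q i" if "i \<in> G" for i
      proof (cases "i < a")
        case True
        then show ?thesis
          using q b \<open>agree_on {..<a} y (\<lambda>i. i \<in> T')\<close> eq by (auto simp: agree_on_def)
      next
        case False
        then show ?thesis using * G_b' \<open>i \<in> G\<close> by (auto simp: agree_on_def)
      qed
      then show False using E[of y] that(2) eq by (auto simp: agree_on_def)
    qed
  qed
  then show ?case using b by (intro exI[of _ b'] conjI exI[of _ q]) (auto simp: b'_def)
qed

lemma block_avoid:
  fixes E :: "nat \<Rightarrow> (nat \<Rightarrow> bool) set"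
  assumes "\<And>n. cyl_nowhere_dense UNIV (E n)"
  shows "\<exists>b w. b > a \<and> (\<exists>i\<in>{a..<b}. w i) \<and> (\<forall>n\<le>m. \<forall>y\<in>E n. \<not> agree_on {a..<b} y w)"
proof -
  obtain b w where b: "b \<ge> a" and
    w: "\<forall>(T, n)\<in>Pow {..<a} \<times> {..m}. \<forall>y\<in>E n.
           agree_on {..<a} y (\<lambda>i. i \<in> T) \<longrightarrow> \<not> agree_on {a..<b} y w"
    using finite_prefixes_avoid[of "Pow {..<a} \<times> {..m}" E a] assms by auto
  \<comment> \<open>One more place, with value \<open>True\<close>, is appended: agreement only gets
    harder, and the block acquires a true place.\<close>
  have "\<not> agree_on {a..<Suc b} y (w(b := True))" if "n \<le> m" "y \<in> E n" for n y
  proof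
    assume *: "agree_on {a..<Suc b} y (w(b := True))"
    have "agree_on {a..<b} y w" using * by (auto simp: agree_on_def)
    moreover have "agree_on {..<a} y (\<lambda>i. i \<in> {i. i < a \<and> y i})"
      by (auto simp: agree_on_def)
    ultimately show False using w that by blast
  qed
  moreover have "\<exists>i\<in>{a..<Suc b}. (w(b := True)) i"
    using b by (intro bexI[of _ b]) simp_all
  moreover have "Suc b > a" using b by simp
  ultimately show ?thesis by blast
qed

lemma interval_partition_unique:
  fixes j :: "nat \<Rightarrow> nat"
  assumes "strict_mono j" "i \<in> {j m..<j (Suc m)}" "i \<in> {j k..<j (Suc k)}"
  shows "m = k"
proof (rule ccontr)
  assume "m \<noteq> k"
  then have "Suc m \<le> k \<or> Suc k \<le> m" by linarith
  then have "j (Suc m) \<le> j k \<or> j (Suc k) \<le> j m"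
    using strict_mono_leD[OF assms(1)] by blast
  then show False using assms(2,3) by auto
qed

text \<open>Iterating \<open>block_avoid\<close> from 0, with block \<open>m\<close> built against
  \<open>E 0\<close>, ..., \<open>E m\<close>, and gluing the segments. The pair
  \<open>(x, j)\<close> is a chopped real, the usual combinatorial code of a meager set.\<close>

lemma blocks_avoid:
  fixes E :: "nat \<Rightarrow> (nat \<Rightarrow> bool) set"
  assumes "\<And>n. cyl_nowhere_dense UNIV (E n)"
  obtains x j where "strict_mono j" "\<And>m. \<exists>i\<in>{j m..<j (Suc m)}. x i"
    "\<And>m n y. n \<le> m \<Longrightarrow> y \<in> E n \<Longrightarrow> \<not> agree_on {j m..<j (Suc m)} y x"
proof -
  define R where "R a m b w \<longleftrightarrow> b > a \<and> (\<exists>i\<in>{a..<b}. w i) \<and>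
    (\<forall>n\<le>m. \<forall>y\<in>E n. \<not> agree_on {a..<b} y w)" for a m b w
  have "\<forall>a m. \<exists>b w. R a m b w"
    unfolding R_def by (intro allI block_avoid assms)
  then obtain B W where BW: "\<And>a m. R a m (B a m) (W a m)" by metis
  have B: "\<And>a m. B a m > a" and W: "\<And>a m. \<exists>i\<in>{a..<B a m}. W a m i"
    and E: "\<And>a m n y. n \<le> m \<Longrightarrow> y \<in> E n \<Longrightarrow> \<not> agree_on {a..<B a m} y (W a m)"
    using BW unfolding R_def by simp_all
  define j where "j = rec_nat 0 (\<lambda>m a. B a m)"
  have jS: "j (Suc m) = B (j m) m" for m by (simp add: j_def)
  have mono: "strict_mono j"
    unfolding strict_mono_Suc_iff jS using B by simp
  define x where "x i = (\<exists>m. i \<in> {j m..<j (Suc m)} \<and> W (j m) m i)" for i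
  have x: "x i = W (j m) m i" if "i \<in> {j m..<j (Suc m)}" for i m
  proof
    assume "x i"
    then obtain k where "i \<in> {j k..<j (Suc k)}" "W (j k) k i" unfolding x_def by blast
    moreover from this(1) have "k = m" by (rule interval_partition_unique[OF mono _ that])
    ultimately show "W (j m) m i" by simp
  next
    assume "W (j m) m i"
    then show "x i" using that unfolding x_def by blast
  qed
  show thesis
  proof
    show "strict_mono j" by (rule mono)
    show "\<exists>i\<in>{j m..<j (Suc m)}. x i" for m
    proof -
      obtain i where "i \<in> {j m..<j (Suc m)}" "W (j m) m i" using W[of "j m" m] unfolding jS by blast
      then show ?thesis using x by blast
    qed
    show "\<not> agree_on {j m..<j (Suc m)} y x" if "n \<le> m" "y \<in> E n" for m n y
    proof -
      have "agree_on {j m..<j (Suc m)} x (W (j m) m)" 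
        unfolding agree_on_def by (intro ballI x)
      then show ?thesis using E[OF that, of "j m"] unfolding jS agree_on_def by simp
    qed
  qed
qed

section \<open>Binary expansions and meager sets of reals\<close>

text \<open>Digits are read off along the doubling map of \<open>[0,1)\<close>. Dyadic rationals get
  the expansion ending in \<open>False\<close>, so a sequence that is eventually \<open>True\<close>
  never arises from a point of \<open>[0,1)\<close>.\<close>

primrec nth_bit :: "nat \<Rightarrow> real \<Rightarrow> bool" where
  "nth_bit 0 r \<longleftrightarrow> r \<ge> 1/2"
| "nth_bit (Suc n) r \<longleftrightarrow> nth_bit n (if r < 1/2 then 2 * r else 2 * r - 1)"

definition bits :: "real \<Rightarrow> nat \<Rightarrow> bool" where
  "bits r = (\<lambda>n. nth_bit n r)"

text \<open>Induction on the number of digits: the first digit selects a half of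
  \<open>[0,1)\<close>, which the doubling map stretches affinely onto \<open>[0,1)\<close>, where
  the remaining digits are read.\<close>

lemma bits_prefix_interval:
  "\<exists>a\<ge>0. a + 1 / 2 ^ n \<le> 1 \<and> {r\<in>{0..<1}. agree_on {..<n} (bits r) y} = {a..<a + 1 / 2 ^ n}"
proof (induction n arbitrary: y)
  case 0
  then show ?case by (intro exI[of _ 0]) (auto simp: agree_on_def)
next
  case (Suc n)
  obtain a where a: "a \<ge> 0" "a + 1 / 2 ^ n \<le> 1"
    "{r\<in>{0..<1}. agree_on {..<n} (bits r) (\<lambda>i. y (Suc i))} = {a..<a + 1 / 2 ^ n}"
    using Suc.IH by blast
  have step: "agree_on {..<Suc n} (bits r) y \<longleftrightarrow>
      (r \<ge> 1/2 \<longleftrightarrow> y 0) \<and>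
      agree_on {..<n} (bits (if r < 1/2 then 2 * r else 2 * r - 1)) (\<lambda>i. y (Suc i))" for r
    by (auto simp: agree_on_def bits_def lessThan_Suc_eq_insert_0)
  have mem: "s \<in> {0..<1} \<and> agree_on {..<n} (bits s) (\<lambda>i. y (Suc i)) \<longleftrightarrow> s \<in> {a..<a + 1 / 2 ^ n}" for s
    using a(3) by blast
  \<comment> \<open>Left end of the preimage of \<open>[a, a + 1/2^n)\<close> under the branch of
    the doubling map that \<open>y 0\<close> selects.\<close>
  define c where "c = (of_bool (y 0) + a) / 2"
  have pow: "1 / 2 ^ Suc n = (1 / 2 ^ n) / (2::real)" by simp
  have "r \<in> {0..<1} \<and> agree_on {..<Suc n} (bits r) y \<longleftrightarrow> r \<in> {c..<c + 1 / 2 ^ Suc n}" for r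
  proof (cases "y 0")
    case True
    then have "r \<in> {0..<1} \<and> agree_on {..<Suc n} (bits r) y \<longleftrightarrow>
       2 * r - 1 \<in> {0..<1} \<and> agree_on {..<n} (bits (2 * r - 1)) (\<lambda>i. y (Suc i))"
      unfolding step by auto
    also have "\<dots> \<longleftrightarrow> 2 * r - 1 \<in> {a..<a + 1 / 2 ^ n}" by (rule mem)
    also have "\<dots> \<longleftrightarrow> r \<in> {c..<c + 1 / 2 ^ Suc n}"
      unfolding pow c_def using True by (auto simp: field_simps)
    finally show ?thesis .
  next
    case False
    then have "r \<in> {0..<1} \<and> agree_on {..<Suc n} (bits r) y \<longleftrightarrow>
       2 * r \<in> {0..<1} \<and> agree_on {..<n} (bits (2 * r)) (\<lambda>i. y (Suc i))"
      unfolding step by auto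
    also have "\<dots> \<longleftrightarrow> 2 * r \<in> {a..<a + 1 / 2 ^ n}" by (rule mem)
    also have "\<dots> \<longleftrightarrow> r \<in> {c..<c + 1 / 2 ^ Suc n}"
      unfolding pow c_def using False by (auto simp: field_simps)
    finally show ?thesis .
  qed
  then have "{r\<in>{0..<1}. agree_on {..<Suc n} (bits r) y} = {c..<c + 1 / 2 ^ Suc n}"
    by (intro set_eqI) simp
  moreover have "c \<ge> 0" "c + 1 / 2 ^ Suc n \<le> 1"
  proof -
    have "(b + a) / 2 \<ge> 0 \<and> (b + a) / 2 + d / 2 \<le> 1" if "0 \<le> b" "b \<le> 1" "a + d \<le> 1" for b d :: real
      using that a(1) by (simp add: field_simps)
    from this[of "of_bool (y 0)", OF _ _ a(2)] show "c \<ge> 0" "c + 1 / 2 ^ Suc n \<le> 1"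
      unfolding pow c_def by simp_all
  qed
  ultimately show ?case by (intro exI[of _ c]) simp
qed

lemma half_mem_dyadic: "a + 1 / 2 ^ n / 2 \<in> {a<..<a + 1 / 2 ^ n :: real}"
proof -
  have "a + d / 2 \<in> {a<..<a + d}" if "d > 0" for d :: real using that by simp
  from this[of "1 / 2 ^ n"] show ?thesis by (simp only: zero_less_divide_1_iff zero_less_power zero_less_numeral)
qed

text \<open>The open dyadic interval of a condition contains a point \<open>r\<close> outside
  \<open>C\<close>. As \<open>C\<close> is closed, a short enough dyadic interval around
  \<open>r\<close> misses it too, and the digits of \<open>r\<close> give the extension.\<close>

lemma cyl_nowhere_dense_bits:
  assumes "closed C" "interior C = {}"
  shows "cyl_nowhere_dense UNIV (bits ` (C \<inter> {0..<1}))"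
  unfolding cyl_nowhere_dense_def
proof (intro allI impI)
  fix F :: "nat set" and p :: "nat \<Rightarrow> bool"
  assume "finite F \<and> F \<subseteq> UNIV"
  then obtain n where n: "F \<subseteq> {..<n}"
    by (meson finite_nat_bounded)
  obtain a where a: "a \<ge> 0" "a + 1 / 2 ^ n \<le> 1"
    "{r\<in>{0..<1}. agree_on {..<n} (bits r) p} = {a..<a + 1 / 2 ^ n}"
    using bits_prefix_interval by blast
  have "{a<..<a + 1 / 2 ^ n} \<noteq> {}" using half_mem_dyadic[of a n] by blast
  then have "\<not> {a<..<a + 1 / 2 ^ n} \<subseteq> C"
    using assms(2) by (metis interior_maximal open_greaterThanLessThan subset_empty)
  then obtain r where r: "r \<in> {a<..<a + 1 / 2 ^ n}" "r \<notin> C" by blast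
  then obtain e where e: "e > 0" "ball r e \<inter> C = {}"
    using assms(1) unfolding closed_def open_contains_ball by blast
  obtain k where k: "(1/2::real) ^ k < e"
    using e real_arch_pow_inv[of e "1/2"] by auto
  have r01: "r \<in> {0..<1}" using r a by auto
  obtain c where c: "c \<ge> 0"
    "{s\<in>{0..<1}. agree_on {..<max n k} (bits s) (bits r)} = {c..<c + 1 / 2 ^ max n k}"
    using bits_prefix_interval by blast
  have small: "(1::real) / 2 ^ max n k \<le> (1/2) ^ k"
    unfolding power_one_over by (intro divide_left_mono power_increasing) simp_all
  have "r \<in> {s\<in>{0..<1}. agree_on {..<max n k} (bits s) (bits r)}" using r01 by simp
  then have rc: "r \<in> {c..<c + 1 / 2 ^ max n k}" unfolding c(2) .
  have "s \<notin> C" if "s \<in> {0..<1}" "agree_on {..<max n k} (bits s) (bits r)" for s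
  proof -
    have "s \<in> {c..<c + 1 / 2 ^ max n k}" using that c(2) by blast
    with rc have "\<bar>r - s\<bar> < 1 / 2 ^ max n k" by auto
    then have "s \<in> ball r e" using small k by (simp add: dist_real_def)
    then show ?thesis using e(2) by blast
  qed
  moreover have "agree_on F (bits r) p"
  proof -
    have "r \<in> {r\<in>{0..<1}. agree_on {..<n} (bits r) p}" unfolding a(3) using r(1) by auto
    then show ?thesis using agree_on_subset n by blast
  qed
  ultimately show "\<exists>G q. finite G \<and> F \<subseteq> G \<and> G \<subseteq> UNIV \<and> agree_on F q p \<and>
      (\<forall>z\<in>bits ` (C \<inter> {0..<1}). \<not> agree_on G z q)"
    using n by (intro exI[of _ "{..<max n k}"] exI[of _ "bits r"]) auto
qed

text \<open>Transfer back to the line: in a ball inside the closure, the extension \<open>q\<close>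
  singles out a dyadic interval without points of the set. Only its interior is open, so only the
  interior is known to miss the closure.\<close>

lemma nowhere_dense_in_bits_vimage:
  assumes "cyl_nowhere_dense UNIV E"
  shows "nowhere_dense_in euclidean {r\<in>{0..<1}. bits r \<in> E}" (is "nowhere_dense_in _ ?R")
proof -
  have "interior (closure ?R) = {}"
  proof (rule ccontr)
    assume "interior (closure ?R) \<noteq> {}"
    then have "interior (closure ?R) \<inter> ?R \<noteq> {}"
      using open_Int_closure_eq_empty[OF open_interior, of "closure ?R" ?R] interior_subset by blast
    then obtain r where r: "r \<in> interior (closure ?R)" "r \<in> ?R" by blast
    obtain e where e: "e > 0" "ball r e \<subseteq> closure ?R"
      using r(1) by (meson mem_interior)
    obtain k where k: "(1/2::real) ^ k < e"
      using e real_arch_pow_inv[of e "1/2"] by auto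
    obtain c where c: "{s\<in>{0..<1}. agree_on {..<k} (bits s) (bits r)} = {c..<c + 1 / 2 ^ k}"
      using bits_prefix_interval by blast
    have "r \<in> {s\<in>{0..<1}. agree_on {..<k} (bits s) (bits r)}" using r(2) by simp
    then have rc: "r \<in> {c..<c + 1 / 2 ^ k}" unfolding c .
    obtain G q where G: "finite G" "{..<k} \<subseteq> G"
      and q: "agree_on {..<k} q (bits r)" and E: "\<And>y. y \<in> E \<Longrightarrow> \<not> agree_on G y q"
      using cyl_nowhere_denseD[OF assms, of "{..<k}" "bits r"] by auto
    obtain n where n: "G \<subseteq> {..<n}" using G finite_nat_bounded by blast
    obtain d where d: "{s\<in>{0..<1}. agree_on {..<n} (bits s) q} = {d..<d + 1 / 2 ^ n}"
      using bits_prefix_interval by blast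
    have "{d<..<d + 1 / 2 ^ n} \<inter> ?R = {}"
    proof -
      have "s \<notin> ?R" if "s \<in> {d..<d + 1 / 2 ^ n}" for s
      proof -
        have "agree_on {..<n} (bits s) q" using that d by blast
        then have "agree_on G (bits s) q" using n agree_on_subset by blast
        then show ?thesis using E by blast
      qed
      then show ?thesis by fastforce
    qed
    then have disj: "{d<..<d + 1 / 2 ^ n} \<inter> closure ?R = {}"
      by (simp add: open_Int_closure_eq_empty)
    \<comment> \<open>The midpoint lies in the open interval, hence outside the closure; it shares
      \<open>k\<close> digits with \<open>r\<close>, hence lies in the ball.\<close>
    define s where "s = d + 1 / 2 ^ n / 2"
    have s: "s \<in> {d<..<d + 1 / 2 ^ n}" unfolding s_def by (rule half_mem_dyadic)
    then have "s \<in> {s\<in>{0..<1}. agree_on {..<n} (bits s) q}" unfolding d by auto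
    then have "s \<in> {s\<in>{0..<1}. agree_on {..<k} (bits s) (bits r)}"
      using n G(2) q by (auto simp: agree_on_def subset_iff)
    then have "s \<in> {c..<c + 1 / 2 ^ k}" using c by blast
    with rc have "\<bar>r - s\<bar> < 1 / 2 ^ k" by auto
    then have "s \<in> ball r e" using k by (simp add: dist_real_def power_one_over)
    then show False using e(2) s disj by blast
  qed
  then show ?thesis by (simp add: nowhere_dense_in_def)
qed

text \<open>The preimage is the sum of the binary series. The doubling map acts on such sums as the
  shift as long as the tail has value below 1. A single \<open>False\<close> in the tail ensures
  this, and having infinitely many is preserved by shifting.\<close>

lemma bits_realize:
  assumes "\<exists>\<^sub>\<infinity>n. \<not> y n"
  obtains r where "r \<in> {0..<1}" "bits r = y"
proof -
  define val where "val y = (\<Sum>n. of_bool (y n) * (1/2::real) ^ Suc n)" for y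
  have sm: "summable (\<lambda>n. (1/2::real) ^ Suc n)"
    using summable_geometric[of "1/2::real"] by (simp add: summable_Suc_iff)
  have sum1: "(\<Sum>n. (1/2::real) ^ Suc n) = 1"
    using power_half_series sums_unique by metis
  have smy: "summable (\<lambda>n. of_bool (y n) * (1/2::real) ^ Suc n)" for y
    by (rule summable_comparison_test'[OF sm, of 0]) simp
  have val0: "val y \<ge> 0" for y
    unfolding val_def by (rule suminf_nonneg[OF smy]) simp
  have val1: "val y < 1" if "\<not> y k" for y k
  proof -
    have "0 < (\<Sum>n. (1/2::real) ^ Suc n - of_bool (y n) * (1/2) ^ Suc n)"
      by (rule suminf_pos2[where i = k]) (use sm smy that in \<open>auto intro: summable_diff\<close>)
    also have "\<dots> = 1 - val y"
      using suminf_diff[OF sm smy[of y]] sum1 by (simp add: val_def)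
    finally show ?thesis by simp
  qed
  have valS: "val y = (of_bool (y 0) + val (\<lambda>n. y (Suc n))) / 2" for y
  proof -
    have "val y = of_bool (y 0) * (1/2) + (\<Sum>n. of_bool (y (Suc n)) * (1/2::real) ^ Suc (Suc n))"
      using suminf_split_head[OF smy[of y]] by (simp add: val_def)
    also have "(\<Sum>n. of_bool (y (Suc n)) * (1/2::real) ^ Suc (Suc n)) = val (\<lambda>n. y (Suc n)) / 2"
      using suminf_divide[OF smy[of "\<lambda>n. y (Suc n)"], of 2] by (simp add: val_def mult.assoc mult.commute)
    finally show ?thesis by (simp add: add_divide_distrib)
  qed
  have bit_val: "nth_bit n (val y) = y n" if "\<exists>\<^sub>\<infinity>n. \<not> y n" for n y
    using that
  proof (induction n arbitrary: y)
    case 0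
    then obtain k where "k > 0" "\<not> y k" unfolding INFM_nat by blast
    then have "val (\<lambda>n. y (Suc n)) < 1" using val1[of "\<lambda>n. y (Suc n)" "k - 1"] by simp
    then show ?case using valS[of y] val0[of "\<lambda>n. y (Suc n)"] by auto
  next
    case (Suc n)
    then obtain k where "k > 0" "\<not> y k" unfolding INFM_nat by blast
    then have lt: "val (\<lambda>n. y (Suc n)) < 1" using val1[of "\<lambda>n. y (Suc n)" "k - 1"] by simp
    have "\<exists>\<^sub>\<infinity>n. \<not> y (Suc n)"
      unfolding INFM_nat
    proof
      fix m
      obtain l where "l > Suc m" "\<not> y l" using Suc.prems unfolding INFM_nat by blast
      then show "\<exists>n>m. \<not> y (Suc n)" by (intro exI[of _ "l - 1"]) auto
    qed
    moreover have "(if val y < 1/2 then 2 * val y else 2 * val y - 1) = val (\<lambda>n. y (Suc n))"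
      using valS[of y] lt val0[of "\<lambda>n. y (Suc n)"] by auto
    ultimately show ?case using Suc.IH[of "\<lambda>n. y (Suc n)"] by simp
  qed
  obtain k where "\<not> y k" using assms unfolding INFM_nat by blast
  then have "val y \<in> {0..<1}" using val0 val1 by auto
  moreover have "bits (val y) = y" using bit_val[OF assms] by (auto simp: bits_def)
  ultimately show thesis by (rule that)
qed

section \<open>Comparing chopped reals, and families capturing sequences of nowhere dense
  sets\<close>

text \<open>The criterion for one chopped real to engulf another: if it holds for almost all
  \<open>k\<close> and both partitions are strictly increasing, then points agreeing with
  \<open>x\<close> on finitely many blocks of \<open>j\<close> agree with \<open>x'\<close> on
  finitely many blocks of \<open>j'\<close>.\<close>

definition matches_block :: "(nat \<Rightarrow> bool) \<Rightarrow> (nat \<Rightarrow> nat) \<Rightarrow> (nat \<Rightarrow> bool) \<Rightarrow> (nat \<Rightarrow> nat) \<Rightarrow> nat \<Rightarrow> bool" where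
  "matches_block x j x' j' k \<longleftrightarrow>
     (\<exists>m. j' k \<le> j m \<and> j (Suc m) \<le> j' (Suc k) \<and> agree_on {j m..<j (Suc m)} x x')"

lemma strict_mono_ge_self:
  fixes j :: "nat \<Rightarrow> nat"
  assumes "strict_mono j"
  shows "n \<le> j n"
  using strict_mono_imp_increasing[OF assms] .

text \<open>
  If infinitely many blocks \<open>k\<close> fail to match, take a sparse sequence \<open>K\<close> of them and let \<open>y\<close> be \<open>x'\<close> on
  these blocks and the negation of \<open>x\<close> elsewhere: then \<open>y\<close> agrees with \<open>x\<close> on no block of \<open>j\<close> although
  it agrees with \<open>x'\<close> on infinitely many blocks of \<open>j'\<close>.  A block of \<open>j\<close> lying in each gap of \<open>K\<close> contains
  a place where \<open>x\<close> is true, so \<open>y\<close> is false infinitely often and is the binary expansion of a real.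
\<close>

lemma eventually_matches_block:
  fixes j j' :: "nat \<Rightarrow> nat" and x x' :: "nat \<Rightarrow> bool"
  assumes j: "strict_mono j" and j': "strict_mono j'"
    and x: "\<And>m. \<exists>i\<in>{j m..<j (Suc m)}. x i"
    and cover: "\<And>r. r \<in> {0..<1} \<Longrightarrow> (\<And>m. \<not> agree_on {j m..<j (Suc m)} (bits r) x) \<Longrightarrow>
                 \<exists>n. \<forall>m\<ge>n. \<not> agree_on {j' m..<j' (Suc m)} (bits r) x'"
  shows "\<exists>k0. \<forall>k\<ge>k0. matches_block x j x' j' k"
proof (rule ccontr)
  assume "\<not> ?thesis"
  then have bad: "\<exists>k\<ge>n. \<not> matches_block x j x' j' k" for n by blast
  have "\<exists>K. \<forall>a. \<not> matches_block x j x' j' (K a) \<and> j (Suc (j' (Suc (K a)))) \<le> K (Suc a)"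
  proof (rule dependent_nat_choice)
    show "\<exists>k. \<not> matches_block x j x' j' k" using bad by blast
    show "\<exists>l. \<not> matches_block x j x' j' l \<and> j (Suc (j' (Suc k))) \<le> l" for k
      using bad[of "j (Suc (j' (Suc k)))"] by blast
  qed
  then obtain K where K_bad: "\<And>a. \<not> matches_block x j x' j' (K a)"
    and K_gap: "\<And>a. j (Suc (j' (Suc (K a)))) \<le> K (Suc a)" by blast
  \<comment> \<open>Block \<open>gap a\<close> of \<open>j\<close> lies between the selected blocks
    \<open>K a\<close> and \<open>K (Suc a)\<close> of \<open>j'\<close>: it starts late enough
    because \<open>n \<le> j n\<close>, and \<open>K_gap\<close> makes it end in time.\<close>
  define gap where "gap a = j' (Suc (K a))" for a
  have gap_lo: "j' (Suc (K a)) \<le> j (gap a)" for a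
    unfolding gap_def by (rule strict_mono_ge_self[OF j])
  have gap_hi: "j (Suc (gap a)) \<le> j' (K (Suc a))" for a
    using K_gap[of a] strict_mono_ge_self[OF j', of "K (Suc a)"] unfolding gap_def by linarith
  have gap_pos: "j (gap a) < j (Suc (gap a))" for a
    using j by (simp add: strict_mono_less)
  have K_mono: "strict_mono K"
  proof (unfold strict_mono_Suc_iff, rule allI)
    fix a
    have "j' (Suc (K a)) < j' (K (Suc a))"
      using gap_lo[of a] gap_pos[of a] gap_hi[of a] by linarith
    then show "K a < K (Suc a)" using j' by (simp add: strict_mono_less)
  qed
  define on where "on i \<longleftrightarrow> (\<exists>a. i \<in> {j' (K a)..<j' (Suc (K a))})" for i
  define y where "y i \<longleftrightarrow> (if on i then x' i else \<not> x i)" for i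
  have off_gap: "\<not> on i" if i: "j' (Suc (K a)) \<le> i" "i < j' (K (Suc a))" for i a
  proof
    assume "on i"
    then obtain b where b: "j' (K b) \<le> i" "i < j' (Suc (K b))" unfolding on_def by auto
    show False
    proof (cases "b \<le> a")
      case True
      then have "K b \<le> K a" using K_mono by (simp add: strict_mono_less_eq)
      then have "j' (Suc (K b)) \<le> j' (Suc (K a))" using j' by (simp add: strict_mono_less_eq)
      then show False using b i by linarith
    next
      case False
      then have "K (Suc a) \<le> K b" using K_mono by (simp add: strict_mono_less_eq)
      then have "j' (K (Suc a)) \<le> j' (K b)" using j' by (simp add: strict_mono_less_eq)
      then show False using b i by linarith
    qed
  qed
  have inf_false: "\<exists>\<^sub>\<infinity>i. \<not> y i"
    unfolding INFM_nat_le
  proof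
    fix n
    obtain i where i: "j (gap n) \<le> i" "i < j (Suc (gap n))" "x i" using x[of "gap n"] by auto
    have "\<not> on i" using off_gap[of n i] gap_lo[of n] gap_hi[of n] i by linarith
    then have "\<not> y i" using i by (simp add: y_def)
    moreover have "n \<le> i"
      using strict_mono_ge_self[OF K_mono, of n] strict_mono_ge_self[OF j', of "Suc (K n)"]
        gap_lo[of n] i by linarith
    ultimately show "\<exists>i\<ge>n. \<not> y i" by blast
  qed
  obtain r where r: "r \<in> {0..<1}" "bits r = y" by (rule bits_realize[OF inf_false])
  have "\<not> agree_on {j m..<j (Suc m)} y x" for m
  proof
    assume "agree_on {j m..<j (Suc m)} y x"
    then have yx: "y i = x i" if "j m \<le> i" "i < j (Suc m)" for i
      using that by (simp add: agree_on_def)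
    \<comment> \<open>Off the selected blocks \<open>y\<close> negates \<open>x\<close>, so
      agreement with \<open>x\<close> forces the whole block of \<open>j\<close> into selected
      ones.\<close>
    have on: "on i" if "j m \<le> i" "i < j (Suc m)" for i
      using yx[OF that] by (auto simp: y_def split: if_splits)
    have jm: "j m < j (Suc m)" using j by (simp add: strict_mono_less)
    obtain a where a: "j' (K a) \<le> j m" "j m < j' (Suc (K a))"
      using on[of "j m"] jm unfolding on_def by auto
    show False
    proof (cases "j (Suc m) \<le> j' (Suc (K a))")
      case True
      have "agree_on {j m..<j (Suc m)} x x'"
        unfolding agree_on_def
      proof
        fix i assume "i \<in> {j m..<j (Suc m)}"
        then have "j m \<le> i" "i < j (Suc m)" by simp_all
        then show "x i = x' i" using yx[of i] on[of i] by (simp add: y_def)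
      qed
      then show False using K_bad[of a] True a(1) unfolding matches_block_def by blast
    next
      case False
      \<comment> \<open>Here the block of \<open>j\<close> runs past the end of the selected block
        \<open>K a\<close>, but the first place beyond that end lies in a gap.\<close>
      have "\<not> on (j' (Suc (K a)))"
        using off_gap[of a "j' (Suc (K a))"] gap_lo[of a] gap_pos[of a] gap_hi[of a] by linarith
      then show False using on[of "j' (Suc (K a))"] False a(2) by linarith
    qed
  qed
  then obtain n where n: "\<And>m. m \<ge> n \<Longrightarrow> \<not> agree_on {j' m..<j' (Suc m)} y x'"
    using cover[OF r(1)] r(2) by blast
  have "agree_on {j' (K n)..<j' (Suc (K n))} y x'"
    unfolding agree_on_def
  proof
    fix i assume "i \<in> {j' (K n)..<j' (Suc (K n))}"
    then have "on i" unfolding on_def by blast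
    then show "y i = x' i" by (simp add: y_def)
  qed
  then show False using n[of "K n"] strict_mono_ge_self[OF K_mono, of n] by blast
qed

text \<open>Successive blocks of \<open>j'\<close> from \<open>k0\<close> on contain blocks of
  \<open>j\<close> of increasing index, so the one inside block \<open>k0 + k\<close> has index at
  least \<open>k\<close>, hence at least \<open>n\<close>. On it \<open>y\<close> differs from
  \<open>x\<close>, which coincides there with \<open>x'\<close>.\<close>

lemma avoid_if_matches_block:
  fixes E :: "nat \<Rightarrow> (nat \<Rightarrow> bool) set"
  assumes j: "strict_mono j" and j': "strict_mono j'"
    and E: "\<And>m n y. n \<le> m \<Longrightarrow> y \<in> E n \<Longrightarrow> \<not> agree_on {j m..<j (Suc m)} y x"
    and match: "\<And>k. k \<ge> k0 \<Longrightarrow> matches_block x j x' j' k"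
    and "n \<le> k" "y \<in> E n"
  shows "\<not> agree_on {j' (k0 + k)..<j' (Suc (k0 + k))} y x'"
proof -
  have "\<exists>m\<ge>k. j' (k0 + k) \<le> j m \<and> j (Suc m) \<le> j' (Suc (k0 + k)) \<and>
          agree_on {j m..<j (Suc m)} x x'" for k
  proof (induction k)
    case 0
    show ?case using match[of k0] unfolding matches_block_def by auto
  next
    case (Suc k)
    then obtain m where m: "m \<ge> k" "j (Suc m) \<le> j' (k0 + Suc k)" by auto
    obtain l where l: "j' (k0 + Suc k) \<le> j l" "j (Suc l) \<le> j' (Suc (k0 + Suc k))"
      "agree_on {j l..<j (Suc l)} x x'"
      using match[of "k0 + Suc k"] unfolding matches_block_def by auto
    have "Suc m \<le> l" using m(2) l(1) j by (meson order_trans strict_mono_less_eq)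
    then show ?case using l m(1) by (intro exI[of _ l]) auto
  qed
  then obtain m where m: "m \<ge> k" "j' (k0 + k) \<le> j m" "j (Suc m) \<le> j' (Suc (k0 + k))"
    "agree_on {j m..<j (Suc m)} x x'" by blast
  have "\<not> agree_on {j m..<j (Suc m)} y x" using E[of n m y] assms(5,6) m(1) by simp
  then obtain i where i: "i \<in> {j m..<j (Suc m)}" "y i \<noteq> x i" unfolding agree_on_def by blast
  then have "y i \<noteq> x' i" using m(4) unfolding agree_on_def by metis
  moreover have "i \<in> {j' (k0 + k)..<j' (Suc (k0 + k))}" using i(1) m(2,3) by auto
  ultimately show ?thesis unfolding agree_on_def by blast
qed

text \<open>Closures of the nowhere dense pieces are used, since
  \<open>cyl_nowhere_dense_bits\<close> is about closed sets; a point of piece \<open>n\<close> is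
  then avoided by all blocks from \<open>n\<close> on.\<close>

lemma meager_avoiding_blocks:
  assumes "meager B"
  obtains x' j' where "strict_mono j'"
    "\<And>r. r \<in> B \<Longrightarrow> r \<in> {0..<1} \<Longrightarrow> \<exists>n. \<forall>m\<ge>n. \<not> agree_on {j' m..<j' (Suc m)} (bits r) x'"
proof -
  obtain N :: "nat \<Rightarrow> real set" where N: "\<And>n. nowhere_dense_in euclidean (N n)" "B \<subseteq> (\<Union>n. N n)"
    using assms unfolding meager_def by blast
  have "cyl_nowhere_dense UNIV (bits ` (closure (N n) \<inter> {0..<1}))" for n
    using N(1)[of n] by (intro cyl_nowhere_dense_bits) (auto simp: nowhere_dense_in_def)
  then obtain x' j' where j': "strict_mono j'" and
    E: "\<And>m n y. n \<le> m \<Longrightarrow> y \<in> bits ` (closure (N n) \<inter> {0..<1}) \<Longrightarrow>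
          \<not> agree_on {j' m..<j' (Suc m)} y x'"
    using blocks_avoid[of "\<lambda>n. bits ` (closure (N n) \<inter> {0..<1})"] by metis
  show thesis
  proof (rule that[OF j'])
    fix r assume r: "r \<in> B" "r \<in> {0..<1::real}"
    then obtain n where "r \<in> N n" using N(2) by blast
    then have "bits r \<in> bits ` (closure (N n) \<inter> {0..<1})"
      using closure_subset[of "N n"] r(2) by blast
    then show "\<exists>n. \<forall>m\<ge>n. \<not> agree_on {j' m..<j' (Suc m)} (bits r) x'" using E by blast
  qed
qed

definition captures :: "(nat \<Rightarrow> bool) \<times> (nat \<Rightarrow> nat) \<Rightarrow> (nat \<Rightarrow> (nat \<Rightarrow> bool) set) \<Rightarrow> bool" where
  "captures h E \<longleftrightarrow>
     (\<forall>n. \<forall>k\<ge>n. \<forall>y\<in>E n. \<not> agree_on {snd h k..<snd h (Suc k)} y (fst h))"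

text \<open>The index \<open>(B, k0)\<close> stands for the chopped real coding \<open>B\<close>
  with its first \<open>k0\<close> blocks dropped. Dropping blocks turns avoidance from some unknown
  block on into avoidance of \<open>E n\<close> from block \<open>n\<close> on, at the cost of a
  countable factor.\<close>

lemma capturing_family:
  assumes "meager_cofinal F"
  shows "\<exists>g :: real set \<times> nat \<Rightarrow> (nat \<Rightarrow> bool) \<times> (nat \<Rightarrow> nat).
    (\<forall>p\<in>F \<times> UNIV. strict_mono (snd (g p))) \<and>
    (\<forall>E. (\<forall>n. cyl_nowhere_dense UNIV (E n)) \<longrightarrow> (\<exists>p\<in>F \<times> UNIV. captures (g p) E))"
proof -
  have mF: "meager B" if "B \<in> F" for B using assms that unfolding meager_cofinal_def by blast
  define good where "good B h \<longleftrightarrow> strict_mono (snd h) \<and>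
    (\<forall>r\<in>B. r \<in> {0..<1} \<longrightarrow> (\<exists>n. \<forall>m\<ge>n. \<not> agree_on {snd h m..<snd h (Suc m)} (bits r) (fst h)))"
    for B and h :: "(nat \<Rightarrow> bool) \<times> (nat \<Rightarrow> nat)"
  have "\<exists>h. good B h" if B: "B \<in> F" for B
  proof (rule meager_avoiding_blocks[OF mF[OF B]])
    fix x' :: "nat \<Rightarrow> bool" and j' :: "nat \<Rightarrow> nat"
    assume "strict_mono j'"
      "\<And>r. r \<in> B \<Longrightarrow> r \<in> {0..<1} \<Longrightarrow> \<exists>n. \<forall>m\<ge>n. \<not> agree_on {j' m..<j' (Suc m)} (bits r) x'"
    then have "good B (x', j')" by (simp add: good_def)
    then show ?thesis by (rule exI)
  qed
  then obtain h where h: "\<And>B. B \<in> F \<Longrightarrow> good B (h B)" by metis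
  define g where "g p = (fst (h (fst p)), \<lambda>k. snd (h (fst p)) (snd p + k))" for p
  show ?thesis
  proof (intro exI[of _ g] conjI ballI allI impI)
    show "strict_mono (snd (g p))" if "p \<in> F \<times> UNIV" for p
      using h[of "fst p"] that by (auto simp: g_def good_def strict_mono_def)
  next
    fix E :: "nat \<Rightarrow> (nat \<Rightarrow> bool) set"
    assume "\<forall>n. cyl_nowhere_dense UNIV (E n)"
    then obtain x j where j: "strict_mono j" and x: "\<And>m. \<exists>i\<in>{j m..<j (Suc m)}. x i"
      and E: "\<And>m n y. n \<le> m \<Longrightarrow> y \<in> E n \<Longrightarrow> \<not> agree_on {j m..<j (Suc m)} y x"
      using blocks_avoid[of E] by metis
    \<comment> \<open>The nowhere dense set coded by the chopped real found for \<open>E\<close>.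
      Some \<open>B\<close> in \<open>F\<close> contains all reals of \<open>[0,1)\<close> with
      digits in \<open>M\<close>, which supplies the covering hypothesis of
      \<open>eventually_matches_block\<close>.\<close>
    define M where "M = {y. \<forall>m. \<not> agree_on {j m..<j (Suc m)} y x}"
    have "cyl_nowhere_dense UNIV M"
      unfolding cyl_nowhere_dense_def
    proof (intro allI impI)
      fix A :: "nat set" and p :: "nat \<Rightarrow> bool"
      assume "finite A \<and> A \<subseteq> UNIV"
      then obtain m where m: "A \<subseteq> {..<m}" using finite_nat_bounded by blast
      have jm: "m \<le> j m" by (rule strict_mono_ge_self[OF j])
      define q where "q i = (if i < j m then p i else x i)" for i
      have "\<not> agree_on {..<j (Suc m)} z q" if "z \<in> M" for z
      proof
        assume "agree_on {..<j (Suc m)} z q"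
        then have "agree_on {j m..<j (Suc m)} z x" by (auto simp: agree_on_def q_def)
        then show False using that by (simp add: M_def)
      qed
      moreover have "agree_on A q p" using m jm by (auto simp: agree_on_def q_def)
      moreover have "A \<subseteq> {..<j (Suc m)}"
        using m jm strict_mono_leD[OF j, of m "Suc m"] by (auto simp: subset_iff intro: less_le_trans)
      ultimately show "\<exists>G q. finite G \<and> A \<subseteq> G \<and> G \<subseteq> UNIV \<and> agree_on A q p \<and>
          (\<forall>z\<in>M. \<not> agree_on G z q)"
        by (intro exI[of _ "{..<j (Suc m)}"] exI[of _ q]) simp
    qed
    then have "nowhere_dense_in euclidean {r\<in>{0..<1}. bits r \<in> M}"
      by (rule nowhere_dense_in_bits_vimage)
    then have "meager {r\<in>{0..<1}. bits r \<in> M}"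
      unfolding meager_def by (intro exI[of _ "\<lambda>_. {r\<in>{0..<1}. bits r \<in> M}"]) simp
    then obtain B where B: "B \<in> F" "{r\<in>{0..<1}. bits r \<in> M} \<subseteq> B"
      using assms unfolding meager_cofinal_def by blast
    have mono: "strict_mono (snd (h B))" using h[OF B(1)] by (simp add: good_def)
    have "\<exists>k0. \<forall>k\<ge>k0. matches_block x j (fst (h B)) (snd (h B)) k"
    proof (rule eventually_matches_block[OF j mono x])
      fix r assume "r \<in> {0..<1::real}" "\<And>m. \<not> agree_on {j m..<j (Suc m)} (bits r) x"
      then have "r \<in> B" using B(2) by (auto simp: M_def)
      then show "\<exists>n. \<forall>m\<ge>n. \<not> agree_on {snd (h B) m..<snd (h B) (Suc m)} (bits r) (fst (h B))"
        using h[OF B(1)] \<open>r \<in> {0..<1}\<close> unfolding good_def by blast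
    qed
    then obtain k0 where k0: "\<And>k. k \<ge> k0 \<Longrightarrow> matches_block x j (fst (h B)) (snd (h B)) k"
      by blast
    have "captures (g (B, k0)) E"
      unfolding captures_def
    proof (intro allI impI ballI)
      fix n k y assume "n \<le> k" "y \<in> E n"
      from avoid_if_matches_block[where E = E and x = x, OF j mono E k0 this]
      show "\<not> agree_on {snd (g (B, k0)) k..<snd (g (B, k0)) (Suc k)} y (fst (g (B, k0)))"
        by (simp add: g_def)
    qed
    then show "\<exists>p\<in>F \<times> UNIV. captures (g p) E" using B(1) by blast
  qed
qed

section \<open>Independent families\<close>

lemma injective_choice:
  fixes T :: "nat \<Rightarrow> 'a set"
  assumes "\<And>m. infinite (T m)"
  obtains c where "inj c" "\<And>m. c m \<in> T m"
proof -
  have "\<exists>c. \<forall>m. c m \<in> T m \<and> c m \<notin> c ` {..<m}"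
  proof (rule dependent_wf_choice[of less_than])
    show "\<exists>r. r \<in> T m \<and> r \<notin> f ` {..<m}" for m and f :: "nat \<Rightarrow> 'a"
    proof -
      have "infinite (T m - f ` {..<m})" using assms by (simp add: Diff_infinite_finite)
      then obtain r where "r \<in> T m - f ` {..<m}" by (metis ex_in_conv infinite_imp_nonempty)
      then show ?thesis by blast
    qed
  next
    fix f g :: "nat \<Rightarrow> 'a" and m r
    assume "\<And>k. (k, m) \<in> less_than \<Longrightarrow> f k = g k"
    then have "f ` {..<m} = g ` {..<m}" by (intro image_cong) auto
    then show "(r \<in> T m \<and> r \<notin> f ` {..<m}) = (r \<in> T m \<and> r \<notin> g ` {..<m})" by simp
  qed (rule wf_less_than)
  then obtain c where c: "\<And>m. c m \<in> T m" "\<And>m. c m \<notin> c ` {..<m}" by blast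
  have "c k \<noteq> c m" if "k < m" for k m
    using c(2)[of m] that by (metis imageI lessThan_iff)
  then have "inj c" by (metis injI linorder_neqE_nat)
  then show thesis using c(1) by (rule that)
qed

text \<open>Each member of the family is visited infinitely often, at pairwise distinct points;
  \<open>S\<close> collects the points of the even visits.\<close>

lemma splitting_set:
  assumes "countable \<T>" "\<And>A. A \<in> \<T> \<Longrightarrow> infinite A"
  obtains S where "\<And>A. A \<in> \<T> \<Longrightarrow> infinite (A \<inter> S)" "\<And>A. A \<in> \<T> \<Longrightarrow> infinite (A - S)"
proof (cases "\<T> = {}")
  case True
  then show thesis using that by blast
next
  case False
  define T where "T m = from_nat_into \<T> (fst (prod_decode m))" for m
  have "infinite (T m)" for m
    unfolding T_def using assms(2) from_nat_into[OF False] by blast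
  then obtain c where c: "inj c" "\<And>m. c m \<in> T m" using injective_choice by blast
  define S where "S = c ` {m. even (snd (prod_decode m))}"
  have inf: "infinite (range (\<lambda>b. c (prod_encode (a, g b))))" if "inj g" for a and g :: "nat \<Rightarrow> nat"
  proof (rule range_inj_infinite)
    show "inj (\<lambda>b. c (prod_encode (a, g b)))"
      using c(1) that by (intro injI) (auto simp: prod_encode_eq inj_eq)
  qed
  have "infinite (A \<inter> S) \<and> infinite (A - S)" if A: "A \<in> \<T>" for A
  proof -
    obtain a where a: "A = from_nat_into \<T> a"
      using from_nat_into_surj[OF assms(1) A] by metis
    have mem: "c (prod_encode (a, b)) \<in> A" for b
      using c(2)[of "prod_encode (a, b)"] by (simp add: T_def a)
    have S: "c (prod_encode (a, b)) \<in> S \<longleftrightarrow> even b" for b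
      unfolding S_def using c(1) by (simp add: inj_image_mem_iff)
    have "range (\<lambda>b. c (prod_encode (a, 2 * b))) \<subseteq> A \<inter> S"
      "range (\<lambda>b. c (prod_encode (a, Suc (2 * b)))) \<subseteq> A - S"
      using mem S by auto
    moreover have "inj (\<lambda>b::nat. 2 * b)" "inj (\<lambda>b::nat. Suc (2 * b))" by (auto simp: inj_def)
    ultimately show ?thesis using inf infinite_super by metis
  qed
  then show thesis using that by blast
qed

section \<open>Recursive construction of guided independent coordinates\<close>

definition block :: "'i set \<Rightarrow> (nat \<Rightarrow> nat) \<Rightarrow> nat \<Rightarrow> 'i set" where
  "block C j k = {l \<in> C. to_nat_on C l \<in> {j k..<j (Suc k)}}"

lemma block_subset: "block C j k \<subseteq> C"
  by (auto simp: block_def)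

lemma finite_block:
  assumes "countable C"
  shows "finite (block C j k)"
proof (rule finite_imageD)
  show "finite (to_nat_on C ` block C j k)"
    by (rule finite_subset[of _ "{j k..<j (Suc k)}"]) (auto simp: block_def)
  show "inj_on (to_nat_on C) (block C j k)"
    by (rule inj_on_subset[OF inj_on_to_nat_on[OF assms] block_subset])
qed

text \<open>When these sets are infinite for all finite conditions, the coordinates are independent
  on \<open>{n} \<times> \<nat>\<close>, with infinitely many witnesses for each condition.\<close>

definition layer :: "('i \<Rightarrow> nat \<times> nat \<Rightarrow> bool) \<Rightarrow> 'i set \<Rightarrow> ('i \<Rightarrow> bool) \<Rightarrow> nat \<Rightarrow> (nat \<times> nat) set" where
  "layer f F p n = {s. fst s = n \<and> agree_on F (\<lambda>i. f i s) p}"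

text \<open>
  The points at which a new coordinate may be true.  The coordinates in \<open>C\<close> are numbered by
  \<open>to_nat_on C\<close>, which need not be onto; a block may therefore contain no coordinate at all.
\<close>

definition guided :: "'i set \<Rightarrow> (nat \<Rightarrow> bool) \<times> (nat \<Rightarrow> nat) \<Rightarrow> ('i \<Rightarrow> nat \<times> nat \<Rightarrow> bool) \<Rightarrow> (nat \<times> nat) set" where
  "guided C h f = {s. \<exists>k\<ge>fst s. agree_on (block C (snd h) k) (\<lambda>i. f i s) (\<lambda>i. fst h (to_nat_on C i))}"

lemma layer_cong:
  assumes "\<And>i. i \<in> F \<Longrightarrow> f i = g i" "\<And>i. i \<in> F \<Longrightarrow> p i = q i"
  shows "layer f F p n = layer g F q n"
  using assms by (simp add: layer_def agree_on_def)

lemma guided_cong: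
  assumes "\<And>i. i \<in> C \<Longrightarrow> f i = g i"
  shows "guided C h f = guided C h g"
  using assms block_subset[of C "snd h"] by (auto simp: guided_def agree_on_def subset_iff)

text \<open>A late block contains no coordinate of \<open>F\<close>, so agreement with the guide on
  that block can be added to \<open>p\<close> without conflict, and the enlarged condition is still
  finite.\<close>

lemma infinite_layer_guided:
  assumes "countable C" "C \<subseteq> L" "strict_mono (snd h)" "finite F" "F \<subseteq> L"
    and indep: "\<And>G q. finite G \<Longrightarrow> G \<subseteq> L \<Longrightarrow> infinite (layer f G q n)"
  shows "infinite (layer f F p n \<inter> guided C h f)"
proof -
  let ?e = "to_nat_on C"
  obtain m where m: "?e ` F \<subseteq> {..<m}" using assms(4) by (meson finite_imageI finite_nat_bounded)
  \<comment> \<open>\<open>guided\<close> asks for \<open>k \<ge> n\<close> at points of layer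
    \<open>n\<close>; \<open>k \<ge> m\<close> moves the block past \<open>F\<close>.\<close>
  define k where "k = max n m"
  have km: "m \<le> snd h k" "n \<le> k"
    using strict_mono_imp_increasing[OF assms(3), of k] by (auto simp: k_def)
  let ?B = "block C (snd h) k"
  have disj: "F \<inter> ?B = {}" using m km(1) by (force simp: block_def)
  define q where "q i = (if i \<in> F then p i else fst h (?e i))" for i
  have "infinite (layer f (F \<union> ?B) q n)"
    using assms(2,4,5) finite_block[OF assms(1)] block_subset[of C "snd h" k] by (intro indep) auto
  moreover have "layer f (F \<union> ?B) q n \<subseteq> layer f F p n \<inter> guided C h f"
  proof
    fix s assume "s \<in> layer f (F \<union> ?B) q n"
    then have s: "fst s = n" "\<And>i. i \<in> F \<union> ?B \<Longrightarrow> f i s = q i"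
      by (simp_all add: layer_def agree_on_def)
    have "agree_on F (\<lambda>i. f i s) p" using s(2) by (simp add: agree_on_def q_def)
    moreover have "agree_on ?B (\<lambda>i. f i s) (\<lambda>i. fst h (?e i))"
      unfolding agree_on_def
    proof
      fix i assume "i \<in> ?B"
      then have "i \<notin> F" "f i s = q i" using disj s(2)[of i] by auto
      then show "f i s = fst h (?e i)" by (simp add: q_def)
    qed
    ultimately show "s \<in> layer f F p n \<inter> guided C h f"
      using s(1) km(2) unfolding layer_def guided_def by blast
  qed
  ultimately show ?thesis using infinite_super by blast
qed

text \<open>There are only countably many finite conditions, so one set \<open>S\<close> splits the
  traces of all layers on \<open>guided C h f\<close>. Intersecting \<open>guided C h f\<close> with
  \<open>S\<close> leaves infinitely many points of each layer inside and outside.\<close>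

lemma independent_extension:
  assumes "countable L" "C \<subseteq> L" "strict_mono (snd h)"
    and indep: "\<And>G q n. finite G \<Longrightarrow> G \<subseteq> L \<Longrightarrow> infinite (layer f G q n)"
  obtains A where "A \<subseteq> guided C h f"
    "\<And>F p n. finite F \<Longrightarrow> F \<subseteq> L \<Longrightarrow> infinite (layer f F p n \<inter> A)"
    "\<And>F p n. finite F \<Longrightarrow> F \<subseteq> L \<Longrightarrow> infinite (layer f F p n - A)"
proof -
  have C: "countable C" using assms(1,2) countable_subset by blast
  define FS where "FS = {A. finite A \<and> A \<subseteq> L}"
  \<comment> \<open>A condition is coded by the finite set \<open>P\<close> of places where it is
    true, which keeps the family countable.\<close>
  define \<T> where "\<T> = (\<lambda>(F, P, n). layer f F (\<lambda>i. i \<in> P) n \<inter> guided C h f) ` (FS \<times> FS \<times> UNIV)"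
  have "countable FS" unfolding FS_def by (rule countable_Collect_finite_subset[OF assms(1)])
  then have "countable \<T>" unfolding \<T>_def by (intro countable_image countable_SIGMA) auto
  moreover have "infinite A" if "A \<in> \<T>" for A
    using that infinite_layer_guided[OF C assms(2,3) _ _ indep] by (auto simp: \<T>_def FS_def)
  ultimately obtain S where S: "\<And>A. A \<in> \<T> \<Longrightarrow> infinite (A \<inter> S)" "\<And>A. A \<in> \<T> \<Longrightarrow> infinite (A - S)"
    using splitting_set by blast
  have \<T>: "layer f F p n \<inter> guided C h f \<in> \<T>" if "finite F" "F \<subseteq> L" for F p n
  proof -
    have "layer f F p n = layer f F (\<lambda>i. i \<in> {i \<in> F. p i}) n" by (rule layer_cong) auto
    moreover have "(F, {i \<in> F. p i}, n) \<in> FS \<times> FS \<times> UNIV" using that by (auto simp: FS_def)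
    ultimately show ?thesis unfolding \<T>_def by force
  qed
  show thesis
  proof (rule that)
    show "guided C h f \<inter> S \<subseteq> guided C h f" by blast
    show "infinite (layer f F p n \<inter> (guided C h f \<inter> S))" if "finite F" "F \<subseteq> L" for F p n
      using S(1)[OF \<T>[OF that]] by (simp add: Int_assoc)
    show "infinite (layer f F p n - (guided C h f \<inter> S))" if "finite F" "F \<subseteq> L" for F p n
      using S(2)[OF \<T>[OF that, of p n]] by (rule infinite_super[rotated]) blast
  qed
qed

text \<open>Well-founded recursion along \<open>R\<close>: each new coordinate splits all layers
  given by finitely many earlier coordinates. Independence on a finite set follows by separating its
  greatest element from the rest.\<close>

lemma guided_independent_family:
  fixes I :: "'i set" and R :: "'i rel"
  assumes wf: "wf R" and trans: "trans R" and total: "total_on I R" and RI: "R \<subseteq> I \<times> I"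
    and cnt: "\<And>i. countable {l. (l, i) \<in> R}"
    and C: "\<And>i. i \<in> I \<Longrightarrow> C i \<subseteq> {l. (l, i) \<in> R}"
    and h: "\<And>i. i \<in> I \<Longrightarrow> strict_mono (snd (h i))"
  obtains f :: "'i \<Rightarrow> nat \<times> nat \<Rightarrow> bool"
  where "\<And>i s. i \<in> I \<Longrightarrow> f i s \<Longrightarrow> s \<in> guided (C i) (h i) f"
    "\<And>F p n. finite F \<Longrightarrow> F \<subseteq> I \<Longrightarrow> infinite (layer f F p n)"
proof -
  \<comment> \<open>The guard \<open>i \<in> I\<close> makes the requirement vacuous outside
    \<open>I\<close>, so that the recursion can run over the whole type.\<close>
  define P where "P f i a \<longleftrightarrow> (i \<in> I \<longrightarrow> Collect a \<subseteq> guided (C i) (h i) f \<and>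
      (\<forall>F p n. finite F \<longrightarrow> F \<subseteq> {l. (l, i) \<in> R} \<longrightarrow>
         infinite (layer f F p n \<inter> Collect a) \<and> infinite (layer f F p n - Collect a)))"
    for f :: "'i \<Rightarrow> nat \<times> nat \<Rightarrow> bool" and i and a
  have indep: "infinite (layer f F p n)"
    if P: "\<And>i. i \<in> L \<Longrightarrow> P f i (f i)" and F: "finite F" "F \<subseteq> L" and L: "L \<subseteq> I" for f L F p n
  proof (cases "F = {}")
    case True
    then have "range (Pair n) \<subseteq> layer f F p n" by (auto simp: layer_def)
    moreover have "infinite (range (Pair n :: nat \<Rightarrow> _))"
      by (intro range_inj_infinite) (simp add: inj_def)
    ultimately show ?thesis using infinite_super by blast
  next
    case False
    have "asymp_on F (\<lambda>x y. (x, y) \<in> R)"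
      using wf_asym[OF wf] by (auto simp: asymp_on_def)
    moreover have "transp_on F (\<lambda>x y. (x, y) \<in> R)"
      using trans by (auto simp: transp_on_def elim: transE)
    ultimately obtain a where a: "a \<in> F" "\<And>x. x \<in> F \<Longrightarrow> x \<noteq> a \<Longrightarrow> (a, x) \<notin> R"
      using Finite_Set.bex_max_element[OF F(1) _ _ False] by blast
    have below: "F - {a} \<subseteq> {l. (l, a) \<in> R}"
    proof
      fix x assume x: "x \<in> F - {a}"
      then have "(x, a) \<in> R \<or> (a, x) \<in> R"
        using total a(1) F(2) L unfolding total_on_def by blast
      then show "x \<in> {l. (l, a) \<in> R}" using a(2) x by blast
    qed
    have aI: "a \<in> I" using a(1) F(2) L by blast
    have "P f a (f a)" using P a(1) F(2) by blast
    then have "infinite (layer f (F - {a}) p n \<inter> Collect (f a))"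
      "infinite (layer f (F - {a}) p n - Collect (f a))"
      unfolding P_def using aI below F(1) by (meson finite_Diff)+
    moreover have "layer f F p n =
        (if p a then layer f (F - {a}) p n \<inter> Collect (f a) else layer f (F - {a}) p n - Collect (f a))"
      using a(1) by (auto simp: layer_def agree_on_def)
    ultimately show ?thesis by simp
  qed
  have "\<exists>f. \<forall>i. P f i (f i)"
  proof (rule dependent_wf_choice[OF wf])
    fix f g :: "'i \<Rightarrow> nat \<times> nat \<Rightarrow> bool" and i a
    assume fg: "\<And>l. (l, i) \<in> R \<Longrightarrow> f l = g l"
    show "P f i a = P g i a"
    proof (cases "i \<in> I")
      case True
      have "guided (C i) (h i) f = guided (C i) (h i) g"
        using C[OF True] fg by (intro guided_cong) auto
      moreover have "layer f F p n = layer g F p n" if "F \<subseteq> {l. (l, i) \<in> R}" for F p n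
        using that fg by (intro layer_cong) auto
      ultimately show ?thesis by (simp add: P_def cong: imp_cong)
    qed (simp add: P_def)
  next
    fix i f
    assume IH: "\<And>l. (l, i) \<in> R \<Longrightarrow> P f l (f l)"
    show "\<exists>a. P f i a"
    proof (cases "i \<in> I")
      case True
      have "infinite (layer f G q n)" if "finite G" "G \<subseteq> {l. (l, i) \<in> R}" for G q n
        by (rule indep[OF _ that]) (use IH RI in auto)
      from independent_extension[OF cnt C[OF True] h[OF True] this]
      obtain A where "A \<subseteq> guided (C i) (h i) f"
        "\<And>F p n. finite F \<Longrightarrow> F \<subseteq> {l. (l, i) \<in> R} \<Longrightarrow> infinite (layer f F p n \<inter> A)"
        "\<And>F p n. finite F \<Longrightarrow> F \<subseteq> {l. (l, i) \<in> R} \<Longrightarrow> infinite (layer f F p n - A)"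
        by (metis (no_types, lifting))
      then have "P f i (\<lambda>s. s \<in> A)" unfolding P_def by simp
      then show ?thesis by blast
    qed (simp add: P_def)
  qed
  then obtain f where f: "\<And>i. P f i (f i)" by blast
  show thesis
  proof (rule that)
    show "s \<in> guided (C i) (h i) f" if "i \<in> I" "f i s" for i s
      using f[of i] that unfolding P_def by blast
    show "infinite (layer f F p n)" if "finite F" "F \<subseteq> I" for F p n
      by (rule indep[OF f that]) simp
  qed
qed

text \<open>Closing off: iterate adding the coordinates of one extension avoiding \<open>E\<^sub>n\<close> for every finite condition.\<close>

lemma cyl_nowhere_dense_countable_support:
  assumes "\<And>n. cyl_nowhere_dense I (E n)"
  obtains C where "countable C" "C \<subseteq> I" "\<And>n::nat. cyl_nowhere_dense C (E n)"
proof -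
  define good where "good n F P G \<longleftrightarrow> finite G \<and> F \<subseteq> G \<and> G \<subseteq> I \<and>
    (\<exists>q. agree_on F q (\<lambda>i. i \<in> P) \<and> (\<forall>z\<in>E n. \<not> agree_on G z q))" for n F P G
  have "\<exists>G. good n F P G" if "finite F" "F \<subseteq> I" for n F P
    using cyl_nowhere_denseD[OF assms[of n] that, of "\<lambda>i. i \<in> P"] unfolding good_def by blast
  then have "\<forall>n F P. \<exists>G. finite F \<and> F \<subseteq> I \<longrightarrow> good n F P G" by blast
  then obtain g where "\<forall>n F P. finite F \<and> F \<subseteq> I \<longrightarrow> good n F P (g n F P)" by metis
  then have g: "\<And>n F P. finite F \<Longrightarrow> F \<subseteq> I \<Longrightarrow> good n F P (g n F P)" by blast
  define FS where "FS D = {A. finite A \<and> A \<subseteq> D}" for D :: "'a set"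
  define step where "step D = D \<union> (\<Union>(n, F, P)\<in>UNIV \<times> FS D \<times> FS D. g n F P)" for D
  define D where "D k = (step ^^ k) {}" for k
  have D: "countable (D k) \<and> D k \<subseteq> I" for k
  proof (induction k)
    case 0
    then show ?case by (simp add: D_def)
  next
    case (Suc k)
    have "countable (FS (D k))" unfolding FS_def using Suc by (simp add: countable_Collect_finite_subset)
    moreover have gI: "finite (g n F P) \<and> g n F P \<subseteq> I" if "F \<in> FS (D k)" for n F P
      using g[of F n P] that Suc unfolding FS_def good_def by blast
    ultimately have "countable (step (D k))"
      unfolding step_def using Suc
      by (intro countable_Un countable_UN countable_SIGMA) (auto intro: countable_finite)
    moreover have "step (D k) \<subseteq> I" using Suc gI unfolding step_def by auto
    ultimately show ?case by (simp add: D_def)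
  qed
  have mono: "D k \<subseteq> D l" if "k \<le> l" for k l
    using that by (rule lift_Suc_mono_le[rotated]) (auto simp: D_def step_def)
  define C where "C = (\<Union>k. D k)"
  have fin: "\<exists>k. F \<subseteq> D k" if "finite F" "F \<subseteq> C" for F
    using that
  proof (induction F rule: finite_induct)
    case (insert x F)
    then obtain k l where "F \<subseteq> D k" "x \<in> D l" by (auto simp: C_def)
    then have "insert x F \<subseteq> D (max k l)" using mono[of k "max k l"] mono[of l "max k l"] by auto
    then show ?case by blast
  qed simp
  show thesis
  proof (rule that)
    show "countable C" "C \<subseteq> I" using D by (auto simp: C_def)
    show "cyl_nowhere_dense C (E n)" for n
      unfolding cyl_nowhere_dense_def
    proof (intro allI impI)
      fix F p assume "finite F \<and> F \<subseteq> C"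
      then obtain k where F: "finite F" "F \<subseteq> D k" using fin by blast
      define P where "P = {i \<in> F. p i}"
      have FI: "F \<subseteq> I" using F D by blast
      obtain q where q: "agree_on F q (\<lambda>i. i \<in> P)" "\<And>z. z \<in> E n \<Longrightarrow> \<not> agree_on (g n F P) z q"
        and G: "finite (g n F P)" "F \<subseteq> g n F P"
        using g[OF F(1) FI, of n P] unfolding good_def by blast
      have "F \<in> FS (D k)" "P \<in> FS (D k)" using F by (auto simp: FS_def P_def)
      then have "g n F P \<subseteq> step (D k)" unfolding step_def by force
      then have "g n F P \<subseteq> D (Suc k)" by (simp add: D_def)
      then have "g n F P \<subseteq> C" by (auto simp: C_def)
      moreover have "agree_on F q p" using q(1) by (auto simp: agree_on_def P_def)
      ultimately show "\<exists>G q. finite G \<and> F \<subseteq> G \<and> G \<subseteq> C \<and> agree_on F q p \<and> (\<forall>z\<in>E n. \<not> agree_on G z q)"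
        using q(2) G by blast
    qed
  qed
qed

lemma cyl_nowhere_dense_mono:
  assumes "cyl_nowhere_dense C E" "C \<subseteq> D"
  shows "cyl_nowhere_dense D E"
  unfolding cyl_nowhere_dense_def
proof (intro allI impI)
  fix F p assume F: "finite F \<and> F \<subseteq> D"
  obtain G q where G: "finite G" "F \<inter> C \<subseteq> G" "G \<subseteq> C" and q: "agree_on (F \<inter> C) q p"
    and E: "\<And>z. z \<in> E \<Longrightarrow> \<not> agree_on G z q"
    using cyl_nowhere_denseD[OF assms(1), of "F \<inter> C" p] F by auto
  \<comment> \<open>\<open>q\<close> takes precedence on \<open>G\<close>. Since
    \<open>G \<subseteq> C\<close>, a conflict with \<open>p\<close> inside \<open>F\<close> could
    occur only on \<open>F \<inter> C\<close>, where both agree.\<close>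
  define q' where "q' i = (if i \<in> G then q i else p i)" for i
  have "agree_on F q' p" using q G(3) by (auto simp: agree_on_def q'_def)
  moreover have "\<not> agree_on (F \<union> G) z q'" if "z \<in> E" for z
    using E[OF that] by (auto simp: agree_on_def q'_def)
  ultimately show "\<exists>G q. finite G \<and> F \<subseteq> G \<and> G \<subseteq> D \<and> agree_on F q p \<and> (\<forall>z\<in>E. \<not> agree_on G z q)"
    using F G assms(2) by (intro exI[of _ "F \<union> G"] exI[of _ q']) auto
qed

text \<open>Transports sets over a numbered set of coordinates to sequences, where
  \<open>captures\<close> applies. The numbering need not be onto; values at numbers that code no
  coordinate stay free.\<close>

lemma cyl_nowhere_dense_reindex:
  fixes e :: "'i \<Rightarrow> 'k"
  assumes "cyl_nowhere_dense C E" "inj_on e C"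
  shows "cyl_nowhere_dense UNIV {y. \<exists>z\<in>E. \<forall>i\<in>C. y (e i) = z i}"
  unfolding cyl_nowhere_dense_def
proof (intro allI impI)
  fix F :: "'k set" and p assume F: "finite F \<and> F \<subseteq> UNIV"
  define F' where "F' = {i \<in> C. e i \<in> F}"
  have "finite F'"
    unfolding F'_def using F assms(2) by (intro finite_inverse_image_gen) auto
  then obtain G q where G: "finite G" "F' \<subseteq> G" "G \<subseteq> C" and q: "agree_on F' q (\<lambda>i. p (e i))"
    and E: "\<And>z. z \<in> E \<Longrightarrow> \<not> agree_on G z q"
    using cyl_nowhere_denseD[OF assms(1), of F' "\<lambda>i. p (e i)"] by (auto simp: F'_def)
  have inv: "inv_into C e (e i) = i" if "i \<in> G" for i
    using G(3) assms(2) that by (auto intro: inv_into_f_f)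
  define q' where "q' m = (if m \<in> e ` G then q (inv_into C e m) else p m)" for m
  have "agree_on F q' p"
    unfolding agree_on_def
  proof
    fix m assume m: "m \<in> F"
    show "q' m = p m"
    proof (cases "m \<in> e ` G")
      case True
      then obtain i where i: "i \<in> G" "m = e i" by blast
      then have "i \<in> F'" using m G(3) by (auto simp: F'_def)
      then show ?thesis using i inv[OF i(1)] q by (simp add: q'_def agree_on_def)
    qed (simp add: q'_def)
  qed
  moreover have "\<not> agree_on (F \<union> e ` G) y q'" if "z \<in> E" "\<forall>i\<in>C. y (e i) = z i" for y z
  proof
    assume *: "agree_on (F \<union> e ` G) y q'"
    have "agree_on G z q"
      unfolding agree_on_def
    proof
      fix i assume i: "i \<in> G"
      then have "z i = q' (e i)" using * that(2) G(3) by (auto simp: agree_on_def)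
      then show "z i = q i" using i inv[OF i] by (simp add: q'_def)
    qed
    then show False using E that(1) by blast
  qed
  ultimately show "\<exists>G q. finite G \<and> F \<subseteq> G \<and> G \<subseteq> UNIV \<and> agree_on F q p \<and>
      (\<forall>z\<in>{y. \<exists>z\<in>E. \<forall>i\<in>C. y (e i) = z i}. \<not> agree_on G z q)"
    using F G(1) by (intro exI[of _ "F \<union> e ` G"] exI[of _ q']) auto
qed

section \<open>Subspaces of Cantor cubes\<close>

lemma topspace_cantor_cube: "topspace (cantor_cube I) = extensional I"
  by (auto simp: cantor_cube_def PiE_def)

lemma openin_cantor_cube_alt:
  "openin (cantor_cube I) U \<longleftrightarrow>
     (\<forall>x\<in>U. \<exists>V. finite {i \<in> I. V i \<noteq> UNIV} \<and> x \<in> Pi\<^sub>E I V \<and> Pi\<^sub>E I V \<subseteq> U)"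
  unfolding cantor_cube_def openin_product_topology_alt by simp

lemma openin_cantor_cube:
  "openin (cantor_cube I) U \<longleftrightarrow> U \<subseteq> extensional I \<and>
     (\<forall>x\<in>U. \<exists>F. finite F \<and> F \<subseteq> I \<and> (\<forall>y\<in>extensional I. agree_on F y x \<longrightarrow> y \<in> U))"
  (is "?L \<longleftrightarrow> _ \<and> ?R")
proof
  assume L: ?L
  have sub: "U \<subseteq> extensional I"
    using openin_subset[OF L] topspace_cantor_cube by metis
  have ?R
  proof
    fix x assume "x \<in> U"
    with L obtain V where V: "finite {i \<in> I. V i \<noteq> UNIV}" "x \<in> Pi\<^sub>E I V" "Pi\<^sub>E I V \<subseteq> U"
      unfolding openin_cantor_cube_alt by blast
    let ?F = "{i \<in> I. V i \<noteq> UNIV}"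
    have "y \<in> U" if y: "y \<in> extensional I" "agree_on ?F y x" for y
    proof -
      have "y i \<in> V i" if "i \<in> I" for i
        using that y(2) V(2) by (cases "V i = UNIV") (auto simp: agree_on_def PiE_def)
      then show ?thesis using V(3) y(1) by (auto simp: PiE_def)
    qed
    then show "\<exists>F. finite F \<and> F \<subseteq> I \<and> (\<forall>y\<in>extensional I. agree_on F y x \<longrightarrow> y \<in> U)"
      using V(1) by (intro exI[of _ ?F]) simp
  qed
  with sub show "U \<subseteq> extensional I \<and> ?R" by blast
next
  assume R: "U \<subseteq> extensional I \<and> ?R"
  show ?L
    unfolding openin_cantor_cube_alt
  proof
    fix x assume x: "x \<in> U"
    with R obtain F where F: "finite F" "F \<subseteq> I" "\<forall>y\<in>extensional I. agree_on F y x \<longrightarrow> y \<in> U"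
      by blast
    define V where "V i = (if i \<in> F then {x i} else UNIV)" for i
    have "finite {i \<in> I. V i \<noteq> UNIV}"
      by (rule finite_subset[OF _ F(1)]) (auto simp: V_def)
    moreover have "x \<in> Pi\<^sub>E I V" using R x by (auto simp: PiE_def V_def)
    moreover have "Pi\<^sub>E I V \<subseteq> U"
    proof
      fix y assume "y \<in> Pi\<^sub>E I V"
      then have "y \<in> extensional I" "agree_on F y x"
        using F(2) by (auto simp: PiE_def Pi_def V_def agree_on_def split: if_splits)
      then show "y \<in> U" using F(3) by blast
    qed
    ultimately show "\<exists>V. finite {i \<in> I. V i \<noteq> UNIV} \<and> x \<in> Pi\<^sub>E I V \<and> Pi\<^sub>E I V \<subseteq> U"
      by blast
  qed
qed

lemma topspace_subtopology_cantor_cube: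
  "S \<subseteq> extensional I \<Longrightarrow> topspace (subtopology (cantor_cube I) S) = S"
  by (simp add: topspace_cantor_cube Int_absorb1)

lemma openin_subtopology_cantor_cube:
  assumes "S \<subseteq> extensional I"
  shows "openin (subtopology (cantor_cube I) S) U \<longleftrightarrow> U \<subseteq> S \<and>
     (\<forall>x\<in>U. \<exists>F. finite F \<and> F \<subseteq> I \<and> (\<forall>y\<in>S. agree_on F y x \<longrightarrow> y \<in> U))"
  (is "?L \<longleftrightarrow> ?R")
proof
  assume ?L
  then obtain T where T: "openin (cantor_cube I) T" "U = T \<inter> S"
    unfolding openin_subtopology by blast
  then show ?R
    using assms unfolding openin_cantor_cube by (metis IntD1 IntI inf_le2 subsetD)
next
  assume R: ?R
  define T where "T = {y \<in> extensional I. \<exists>x\<in>U. \<exists>F. finite F \<and> F \<subseteq> I \<and>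
    (\<forall>z\<in>S. agree_on F z x \<longrightarrow> z \<in> U) \<and> agree_on F y x}"
  have "openin (cantor_cube I) T"
    unfolding openin_cantor_cube
  proof (intro conjI ballI)
    show "T \<subseteq> extensional I" by (auto simp: T_def)
    fix y assume "y \<in> T"
    then obtain x F where x: "x \<in> U" "finite F" "F \<subseteq> I" "\<forall>z\<in>S. agree_on F z x \<longrightarrow> z \<in> U" "agree_on F y x"
      unfolding T_def by blast
    have "y' \<in> T" if "y' \<in> extensional I" "agree_on F y' y" for y'
    proof -
      have "agree_on F y' x" using that(2) x(5) by (simp add: agree_on_def)
      then show ?thesis using that(1) x unfolding T_def by blast
    qed
    then show "\<exists>F. finite F \<and> F \<subseteq> I \<and> (\<forall>y'\<in>extensional I. agree_on F y' y \<longrightarrow> y' \<in> T)"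
      using x(2,3) by blast
  qed
  moreover have "T \<inter> S = U"
  proof
    show "T \<inter> S \<subseteq> U" by (auto simp: T_def)
    show "U \<subseteq> T \<inter> S"
    proof
      fix x assume x: "x \<in> U"
      then obtain F where "finite F" "F \<subseteq> I" "\<forall>y\<in>S. agree_on F y x \<longrightarrow> y \<in> U" using R by blast
      moreover have "x \<in> S" using R x by blast
      moreover have "agree_on F x x" by simp
      ultimately show "x \<in> T \<inter> S" using x assms unfolding T_def by blast
    qed
  qed
  ultimately show ?L unfolding openin_subtopology by blast
qed

lemma openin_cylinder:
  assumes "S \<subseteq> extensional I" "finite F" "F \<subseteq> I"
  shows "openin (subtopology (cantor_cube I) S) {x \<in> S. agree_on F x p}"
  unfolding openin_subtopology_cantor_cube[OF assms(1)]
proof (intro conjI ballI)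
  fix x assume x: "x \<in> {x \<in> S. agree_on F x p}"
  have "y \<in> {x \<in> S. agree_on F x p}" if "y \<in> S" "agree_on F y x" for y
    using that x by (simp add: agree_on_def)
  then show "\<exists>F'. finite F' \<and> F' \<subseteq> I \<and> (\<forall>y\<in>S. agree_on F' y x \<longrightarrow> y \<in> {x \<in> S. agree_on F x p})"
    using assms(2,3) by blast
qed blast

lemma dense_in_subtopology_cantor_cube:
  assumes "S \<subseteq> extensional I"
  shows "dense_in (subtopology (cantor_cube I) S) D \<longleftrightarrow> D \<subseteq> S \<and>
     (\<forall>x\<in>S. \<forall>F. finite F \<longrightarrow> F \<subseteq> I \<longrightarrow> (\<exists>d\<in>D. agree_on F d x))"
  (is "?L \<longleftrightarrow> ?R")
proof -
  have L_iff: "?L \<longleftrightarrow> D \<subseteq> S \<and>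
      (\<forall>T. openin (subtopology (cantor_cube I) S) T \<and> T \<noteq> {} \<longrightarrow> D \<inter> T \<noteq> {})"
    unfolding dense_in_def dense_intersects_open
    unfolding topspace_subtopology_cantor_cube[OF assms] ..
  show ?thesis
    unfolding L_iff
  proof
    assume L: "D \<subseteq> S \<and> (\<forall>T. openin (subtopology (cantor_cube I) S) T \<and> T \<noteq> {} \<longrightarrow> D \<inter> T \<noteq> {})"
    then have D: "D \<subseteq> S" ..
    have meets: "D \<inter> T \<noteq> {}" if "openin (subtopology (cantor_cube I) S) T" "T \<noteq> {}" for T
      using L that by simp
    have "\<exists>d\<in>D. agree_on F d x" if "x \<in> S" "finite F" "F \<subseteq> I" for x F
    proof -
      have "x \<in> {y \<in> S. agree_on F y x}" using that by simp
      then have "{y \<in> S. agree_on F y x} \<noteq> {}" by (rule ex_in_conv[THEN iffD1, OF exI])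
      with openin_cylinder[OF assms that(2,3)] have "D \<inter> {y \<in> S. agree_on F y x} \<noteq> {}" by (rule meets)
      then show ?thesis by blast
    qed
    with D show ?R by blast
  next
    assume R: ?R
    have "D \<inter> T \<noteq> {}" if T: "openin (subtopology (cantor_cube I) S) T" "T \<noteq> {}" for T
    proof -
      obtain x where x: "x \<in> T" using T by blast
      with T obtain F where F: "finite F" "F \<subseteq> I" "\<forall>y\<in>S. agree_on F y x \<longrightarrow> y \<in> T" "x \<in> S"
        unfolding openin_subtopology_cantor_cube[OF assms] by blast
      then obtain d where d: "d \<in> D" "agree_on F d x" using R by blast
      then have "d \<in> T" using F(3) R by blast
      with d(1) show ?thesis by blast
    qed
    with R show "D \<subseteq> S \<and> (\<forall>T. openin (subtopology (cantor_cube I) S) T \<and> T \<noteq> {} \<longrightarrow> D \<inter> T \<noteq> {})"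
      by simp
  qed
qed

section \<open>D-separability, and discrete versus nowhere dense sets\<close>

lemma discrete_in_subsingleton:
  assumes "E \<subseteq> topspace X" "E \<subseteq> {d}"
  shows "discrete_in X E"
proof (cases "E = {}")
  case False
  then have "E = {d}" using assms(2) by blast
  then show ?thesis
    using assms(1) by (simp add: discrete_in_def subtopology_eq_discrete_topology_sing)
qed (simp add: discrete_in_def)

text \<open>One point of \<open>D\<^sub>n\<close> in the \<open>n\<close>-th member of a countable base suffices.\<close>

lemma D_separable_countable_cube:
  assumes I: "countable I" and S: "S \<subseteq> extensional I"
  shows "D_separable (subtopology (cantor_cube I) S)" (is "D_separable ?Y")
  unfolding D_separable_def
proof (intro allI impI)
  fix D assume "\<forall>n::nat. dense_in ?Y (D n)"
  then have D: "\<And>n. D n \<subseteq> S"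
    and dense: "\<And>n x F. x \<in> S \<Longrightarrow> finite F \<Longrightarrow> F \<subseteq> I \<Longrightarrow> \<exists>d\<in>D n. agree_on F d x"
    unfolding dense_in_subtopology_cantor_cube[OF S] by blast+
  define FS where "FS = {A. finite A \<and> A \<subseteq> I}"
  define \<B> where "\<B> = (\<lambda>(F, P). {x \<in> S. agree_on F x (\<lambda>i. i \<in> P)}) ` (FS \<times> FS)"
  have "countable FS" unfolding FS_def by (rule countable_Collect_finite_subset[OF I])
  then have cB: "countable \<B>" unfolding \<B>_def by (intro countable_image countable_SIGMA) auto
  have cyl: "{y \<in> S. agree_on F y x} \<in> \<B>" if F: "finite F" "F \<subseteq> I" for F x
  proof -
    have "{y \<in> S. agree_on F y x} = {y \<in> S. agree_on F y (\<lambda>i. i \<in> {i \<in> F. x i})}"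
      by (simp add: agree_on_def cong: ball_cong)
    moreover have "(F, {i \<in> F. x i}) \<in> FS \<times> FS" using F by (auto simp: FS_def)
    ultimately show ?thesis unfolding \<B>_def by force
  qed
  \<comment> \<open>\<open>D n\<close> is dense and can miss the \<open>n\<close>-th cylinder only
    if that cylinder is empty; then nothing has to be hit.\<close>
  define E where "E n = (if D n \<inter> from_nat_into \<B> n = {} then {} else {SOME d. d \<in> D n \<inter> from_nat_into \<B> n})" for n
  have some: "(SOME d. d \<in> D n \<inter> from_nat_into \<B> n) \<in> D n \<inter> from_nat_into \<B> n"
    if "D n \<inter> from_nat_into \<B> n \<noteq> {}" for n
  proof (rule someI_ex[where P = "\<lambda>d. d \<in> D n \<inter> from_nat_into \<B> n"])
    show "\<exists>d. d \<in> D n \<inter> from_nat_into \<B> n" using that by blast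
  qed
  have ED: "E n \<subseteq> D n" for n using some[of n] by (auto simp: E_def)
  have "discrete_in ?Y (E n)" for n
  proof (rule discrete_in_subsingleton)
    show "E n \<subseteq> topspace ?Y" using ED D topspace_subtopology_cantor_cube[OF S] by blast
    show "E n \<subseteq> {SOME d. d \<in> D n \<inter> from_nat_into \<B> n}" by (simp add: E_def)
  qed
  moreover have "dense_in ?Y (\<Union>n. E n)"
    unfolding dense_in_subtopology_cantor_cube[OF S]
  proof (intro conjI ballI allI impI)
    show "(\<Union>n. E n) \<subseteq> S" using ED D by blast
    fix x F assume x: "x \<in> S" and F: "finite F" "F \<subseteq> I"
    obtain n where n: "from_nat_into \<B> n = {y \<in> S. agree_on F y x}"
      using from_nat_into_surj[OF cB cyl[OF F, of x]] by blast
    obtain d where "d \<in> D n" "agree_on F d x" using dense[OF x F] by blast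
    then have "D n \<inter> from_nat_into \<B> n \<noteq> {}" using n D by blast
    then obtain e where "e \<in> E n" "e \<in> from_nat_into \<B> n" using some[of n] by (simp add: E_def)
    then show "\<exists>d\<in>\<Union>n. E n. agree_on F d x" using n by blast
  qed
  ultimately show "\<exists>E. (\<forall>n. E n \<subseteq> D n \<and> discrete_in ?Y (E n)) \<and> dense_in ?Y (\<Union>n. E n)"
    using ED by (intro exI[of _ E]) simp
qed

text \<open>A point \<open>x\<close> of \<open>E\<close> inside the interior of the closure is
  isolated in \<open>E\<close> by some open \<open>W\<close>. Removing \<open>x\<close> from
  \<open>W\<close> within that interior leaves an open set that misses \<open>E\<close>, hence its
  closure, hence is empty; so \<open>x\<close> would be isolated in \<open>X\<close>.\<close>

lemma nowhere_dense_in_if_discrete_in: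
  assumes "discrete_in X E" and closed_pt: "\<And>x. x \<in> topspace X \<Longrightarrow> closedin X {x}"
    and crowded: "\<And>x. \<not> openin X {x}"
  shows "nowhere_dense_in X E"
proof -
  have E: "E \<subseteq> topspace X" "subtopology X E = discrete_topology E"
    using assms(1) by (simp_all add: discrete_in_def)
  have "X interior_of (X closure_of E) = {}"
  proof (rule ccontr)
    let ?U = "X interior_of (X closure_of E)"
    assume "?U \<noteq> {}"
    moreover have "?U \<subseteq> X closure_of E" by (rule interior_of_subset)
    ultimately have "?U \<inter> X closure_of E \<noteq> {}" by blast
    then obtain x where x: "x \<in> ?U" "x \<in> E"
      using openin_Int_closure_of_eq_empty[OF openin_interior_of, of X "X closure_of E" E] by blast
    have "openin (subtopology X E) {x}" using E(2) x(2) by simp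
    then obtain W where W: "openin X W" "{x} = W \<inter> E" unfolding openin_subtopology by blast
    have "openin X (W \<inter> ?U - {x})"
      using W(1) closed_pt x(2) E(1) by (intro openin_diff openin_Int) auto
    moreover have "(W \<inter> ?U - {x}) \<inter> E = {}" using W(2) by blast
    ultimately have "(W \<inter> ?U - {x}) \<inter> X closure_of E = {}"
      using openin_Int_closure_of_eq_empty by blast
    then have "W \<inter> ?U - {x} = {}" using interior_of_subset[of X "X closure_of E"] by blast
    then have "W \<inter> ?U = {x}" using W(2) x(1) by blast
    moreover have "openin X (W \<inter> ?U)" using W(1) by (intro openin_Int) auto
    ultimately show False using crowded by metis
  qed
  then show ?thesis using E(1) by (simp add: nowhere_dense_in_def)
qed

lemma closedin_singleton_subtopology_cantor_cube:
  assumes "S \<subseteq> extensional I" "x \<in> S"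
  shows "closedin (subtopology (cantor_cube I) S) {x}"
  unfolding closedin_def topspace_subtopology_cantor_cube[OF assms(1)]
    openin_subtopology_cantor_cube[OF assms(1)]
proof (intro conjI ballI)
  fix y assume y: "y \<in> S - {x}"
  then obtain i where i: "i \<in> I" "x i \<noteq> y i"
    using assms extensionalityI[of x I y] by blast
  then have "\<forall>z\<in>S. agree_on {i} z y \<longrightarrow> z \<in> S - {x}" by (auto simp: agree_on_def)
  then show "\<exists>F. finite F \<and> F \<subseteq> I \<and> (\<forall>z\<in>S. agree_on F z y \<longrightarrow> z \<in> S - {x})"
    using i(1) by (intro exI[of _ "{i}"]) simp
qed (use assms in auto)

text \<open>A dense subspace of an infinite cube has closed points and no isolated ones, so its
  discrete sets are nowhere dense and D-separability would imply NWD-separability.\<close>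

lemma not_D_separable_if_not_NWD_separable:
  assumes "infinite I" and dense: "dense_in (cantor_cube I) S"
    and "\<not> NWD_separable (subtopology (cantor_cube I) S)"
  shows "\<not> D_separable (subtopology (cantor_cube I) S)" (is "\<not> D_separable ?Y")
proof
  assume D: "D_separable ?Y"
  have S: "S \<subseteq> extensional I" using dense by (simp add: dense_in_def topspace_cantor_cube)
  have whole: "subtopology (cantor_cube I) (extensional I) = cantor_cube I"
    by (metis subtopology_topspace topspace_cantor_cube)
  have "dense_in (subtopology (cantor_cube I) (extensional I)) S" using dense unfolding whole .
  then have meets: "\<exists>d\<in>S. agree_on F d x" if "x \<in> extensional I" "finite F" "F \<subseteq> I" for x F
    using that unfolding dense_in_subtopology_cantor_cube[OF subset_refl] by simp
  have crowded: "\<not> openin ?Y {x}" for x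
  proof
    assume "openin ?Y {x}"
    then have "x \<in> S \<and> (\<exists>F. finite F \<and> F \<subseteq> I \<and> (\<forall>y\<in>S. agree_on F y x \<longrightarrow> y = x))"
      unfolding openin_subtopology_cantor_cube[OF S] by simp
    then obtain F where x: "x \<in> S" and F: "finite F" "F \<subseteq> I" "\<forall>y\<in>S. agree_on F y x \<longrightarrow> y = x"
      by metis
    \<comment> \<open>A coordinate outside \<open>F\<close> is flipped: a point of \<open>S\<close>
      approximating the result agrees with \<open>x\<close> on \<open>F\<close> without being
      \<open>x\<close>.\<close>
    have "infinite (I - F)" using assms(1) F(1) by (simp add: Diff_infinite_finite)
    then obtain i where i: "i \<in> I" "i \<notin> F" by (metis Diff_iff ex_in_conv infinite_imp_nonempty)
    have "x \<in> extensional I" using x S by (rule subsetD[rotated])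
    then have "x(i := \<not> x i) \<in> extensional I" using i(1) by (simp add: extensional_def)
    then obtain d where d: "d \<in> S" "agree_on (insert i F) d (x(i := \<not> x i))"
      using meets[of "x(i := \<not> x i)" "insert i F"] F i(1) by auto
    have "agree_on F d x" using d(2) i(2) by (auto simp: agree_on_def)
    then have "d = x" using F(3) d(1) by simp
    then show False using d(2) by (simp add: agree_on_def)
  qed
  have "nowhere_dense_in ?Y E" if "discrete_in ?Y E" for E
    using that
  proof (rule nowhere_dense_in_if_discrete_in)
    show "closedin ?Y {x}" if "x \<in> topspace ?Y" for x
      using that closedin_singleton_subtopology_cantor_cube[OF S]
      unfolding topspace_subtopology_cantor_cube[OF S] by blast
  qed (rule crowded)
  then have "(\<forall>n. E n \<subseteq> D n \<and> discrete_in ?Y (E n)) \<Longrightarrow>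
      \<forall>n. E n \<subseteq> D n \<and> nowhere_dense_in ?Y (E n)" for E D :: "nat \<Rightarrow> ('a \<Rightarrow> bool) set"
    by simp
  then have "NWD_separable ?Y"
    using D unfolding NWD_separable_def D_separable_def by metis
  with assms(3) show False by simp
qed

text \<open>By density of \<open>S\<close> every condition is met in \<open>S\<close>, so its
  cylinder contains a point \<open>x\<close> of \<open>S\<close> outside the closure of
  \<open>E\<close>; this \<open>x\<close> serves as the extension \<open>q\<close>.\<close>

lemma cyl_nowhere_dense_if_nowhere_dense_in:
  assumes S: "S \<subseteq> extensional I"
    and meets: "\<And>F p. finite F \<Longrightarrow> F \<subseteq> I \<Longrightarrow> \<exists>d\<in>S. agree_on F d p"
    and E: "nowhere_dense_in (subtopology (cantor_cube I) S) E"
  shows "cyl_nowhere_dense I E"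
  unfolding cyl_nowhere_dense_def
proof (intro allI impI)
  let ?Y = "subtopology (cantor_cube I) S"
  have ES: "E \<subseteq> S" and int: "?Y interior_of (?Y closure_of E) = {}"
    using E by (simp_all add: nowhere_dense_in_def topspace_subtopology_cantor_cube[OF S])
  fix F p assume F: "finite F \<and> F \<subseteq> I"
  define U where "U = {x \<in> S. agree_on F x p}"
  have "openin ?Y U" unfolding U_def using F by (intro openin_cylinder[OF S]) auto
  moreover have "U \<noteq> {}" using meets[of F p] F by (auto simp: U_def)
  ultimately have "\<not> U \<subseteq> ?Y closure_of E"
    using int unfolding interior_of_eq_empty by blast
  then obtain x where x: "x \<in> S" "agree_on F x p" "x \<notin> ?Y closure_of E" by (auto simp: U_def)
  then obtain T where T: "x \<in> T" "openin ?Y T" "T \<inter> E = {}"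
    unfolding in_closure_of topspace_subtopology_cantor_cube[OF S] by blast
  then obtain G where G: "finite G" "G \<subseteq> I" "\<forall>y\<in>S. agree_on G y x \<longrightarrow> y \<in> T"
    unfolding openin_subtopology_cantor_cube[OF S] by blast
  have "\<not> agree_on (F \<union> G) z x" if "z \<in> E" for z
  proof
    assume "agree_on (F \<union> G) z x"
    then have "agree_on G z x" by (rule agree_on_subset) simp
    then show False using G(3) T(3) ES that by blast
  qed
  then show "\<exists>G q. finite G \<and> F \<subseteq> G \<and> G \<subseteq> I \<and> agree_on F q p \<and> (\<forall>z\<in>E. \<not> agree_on G z q)"
    using F G(1,2) x(2) by (intro exI[of _ "F \<union> G"] exI[of _ x]) auto
qed

section \<open>The non-separable subspace\<close>

unbundle cardinal_syntax

section \<open>Index sets of cardinality \<open>omega1\<close>\<close>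

lemma ordLess_omega1_iff_countable:
  assumes "Card_order r"
  shows "r <o omega1 \<longleftrightarrow> r \<le>o natLeq"
  by (rule cardSuc_ordLeq_ordLess[OF natLeq_Card_order assms])

lemma countable_underS_omega1:
  assumes "|I| =o omega1"
  shows "countable (underS |I| i)"
proof (cases "i \<in> I")
  case True
  have "|underS |I| i| <o |I|"
    using card_of_underS[OF card_of_Card_order] True by (simp add: Field_card_of)
  then have "|underS |I| i| <o omega1" using assms ordLess_ordIso_trans by blast
  then show ?thesis
    using ordLess_omega1_iff_countable[OF card_of_Card_order] countable_card_le_natLeq by blast
next
  case False
  then have "underS |I| i = {}"
    using Field_card_of[of I] by (auto simp: underS_def Field_def)
  then show ?thesis by simp
qed

lemma uncountable_if_card_omega1:
  assumes "|I| =o omega1"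
  shows "\<not> countable I"
proof
  assume "countable I"
  then have "|I| <o omega1"
    using ordLess_omega1_iff_countable[OF card_of_Card_order] countable_card_le_natLeq by blast
  then show False using assms not_ordLess_ordIso by blast
qed

text \<open>\<open>I\<close> is mapped onto \<open>(I \<times> H) \<times> I\<close> and the last
  component is dropped; that component still maps each fibre onto the uncountable set
  \<open>I\<close>.\<close>

lemma enumeration_with_uncountable_fibres:
  assumes I: "|I| =o omega1" and H: "|H| \<le>o |I|" "H \<noteq> {}"
  obtains t where "\<And>i. i \<in> I \<Longrightarrow> t i \<in> I \<times> H"
    "\<And>a h. a \<in> I \<Longrightarrow> h \<in> H \<Longrightarrow> \<not> countable {i \<in> I. t i = (a, h)}"
proof -
  have unc: "\<not> countable I" by (rule uncountable_if_card_omega1[OF I])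
  then have inf: "infinite I" "I \<noteq> {}" by (auto intro: countable_finite)
  have "|I \<times> H| \<le>o |I|"
    by (intro card_of_Sigma_ordLeq_infinite inf ballI H(1)) (simp add: card_of_mono1)
  then have "|(I \<times> H) \<times> I| \<le>o |I|"
    by (rule card_of_Sigma_ordLeq_infinite[OF inf(1)]) (simp add: card_of_mono1)
  moreover have "(I \<times> H) \<times> I \<noteq> {}" using inf H(2) by blast
  ultimately obtain g where g: "g ` I = (I \<times> H) \<times> I" using card_of_ordLeq2 by metis
  show thesis
  proof (rule that)
    show "fst (g i) \<in> I \<times> H" if "i \<in> I" for i
      using that g by (metis imageI mem_Times_iff)
  next
    fix a h assume ah: "a \<in> I" "h \<in> H"
    show "\<not> countable {i \<in> I. fst (g i) = (a, h)}"
    proof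
      assume "countable {i \<in> I. fst (g i) = (a, h)}"
      then have "countable ((\<lambda>i. snd (g i)) ` {i \<in> I. fst (g i) = (a, h)})" by (rule countable_image)
      moreover have "I \<subseteq> (\<lambda>i. snd (g i)) ` {i \<in> I. fst (g i) = (a, h)}"
      proof
        fix b assume "b \<in> I"
        then have "((a, h), b) \<in> g ` I" using ah g by simp
        then obtain i where "i \<in> I" "g i = ((a, h), b)" by force
        then show "b \<in> (\<lambda>i. snd (g i)) ` {i \<in> I. fst (g i) = (a, h)}" by force
      qed
      ultimately show False using unc countable_subset by blast
    qed
  qed
qed

text \<open>Apply capture to the \<open>y\<close> that copies \<open>z\<close> along
  \<open>e\<close> and copies the guide at all numbers coding no element of \<open>C\<close>. Its
  disagreement with the guide must then sit at a coded place.\<close>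

lemma not_guided_if_captured:
  assumes "inj_on e C" and cap: "captures h (\<lambda>n. {y. \<exists>z\<in>E n. \<forall>i\<in>C. y (e i) = z i})"
    and z: "z \<in> E n" and k: "n \<le> k"
  shows "\<exists>i\<in>C. e i \<in> {snd h k..<snd h (Suc k)} \<and> z i \<noteq> fst h (e i)"
proof -
  define y where "y m = (if m \<in> e ` C then z (inv_into C e m) else fst h m)" for m
  have ye: "y (e i) = z i" if "i \<in> C" for i
    using that assms(1) by (simp add: y_def)
  then have "y \<in> {y. \<exists>z\<in>E n. \<forall>i\<in>C. y (e i) = z i}" using z by blast
  then have "\<not> agree_on {snd h k..<snd h (Suc k)} y (fst h)"
    using cap k unfolding captures_def by blast
  then obtain m where m: "m \<in> {snd h k..<snd h (Suc k)}" "y m \<noteq> fst h m"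
    unfolding agree_on_def by blast
  then have "m \<in> e ` C" unfolding y_def by metis
  then obtain i where i: "i \<in> C" "m = e i" by blast
  then show ?thesis using m ye[OF i(1)] by (intro bexI[of _ i]) simp_all
qed

lemma dense_subspace_not_NWD_separable:
  fixes I :: "'i set"
  assumes I: "|I| =o omega1" and cof: "cof_meager_eq_omega1"
  shows "\<exists>S. dense_in (cantor_cube I) S \<and> countable S \<and>
              \<not> NWD_separable (subtopology (cantor_cube I) S)"
proof -
  obtain F where F: "meager_cofinal F" "|F| =o omega1"
    using cof unfolding cof_meager_eq_omega1_def by blast
  obtain g :: "real set \<times> nat \<Rightarrow> (nat \<Rightarrow> bool) \<times> (nat \<Rightarrow> nat)" where g: "(\<forall>p\<in>F \<times> UNIV. strict_mono (snd (g p))) \<and>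
      (\<forall>E. (\<forall>n. cyl_nowhere_dense UNIV (E n)) \<longrightarrow> (\<exists>p\<in>F \<times> UNIV. captures (g p) E))"
    using capturing_family[OF F(1)] ..
  have g_mono: "strict_mono (snd (g p))" if "p \<in> F \<times> UNIV" for p
    by (rule bspec[OF conjunct1[OF g] that])
  have g_cap: "\<exists>p\<in>F \<times> UNIV. captures (g p) E" if "\<And>n. cyl_nowhere_dense UNIV (E n)" for E
    by (rule conjunct2[OF g, THEN spec, THEN mp]) (simp add: that)
  have unc: "\<not> countable I" by (rule uncountable_if_card_omega1[OF I])
  then have inf: "infinite I" by (auto intro: countable_finite)
  define H where "H = F \<times> (UNIV :: nat set)"
  have HI: "|H| \<le>o |I|"
  proof -
    have "|F| \<le>o |I|" using F(2) I by (meson ordIso_imp_ordLeq ordIso_symmetric ordIso_transitive)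
    moreover have "|UNIV :: nat set| \<le>o |I|" using inf infinite_iff_card_of_nat by blast
    ultimately show ?thesis
      unfolding H_def by (intro card_of_Sigma_ordLeq_infinite inf ballI)
  qed
  have H: "H \<noteq> {}"
  proof (rule bexE[OF g_cap[of "\<lambda>_. {}", OF cyl_nowhere_dense_empty]])
    fix p assume "p \<in> F \<times> (UNIV :: nat set)"
    then show ?thesis unfolding H_def by (rule ex_in_conv[THEN iffD1, OF exI])
  qed
  \<comment> \<open>Stage \<open>i\<close> receives a guess \<open>(a, p)\<close>: an initial
    segment \<open>below a\<close> and the index of a pair. Every guess recurs uncountably
    often.\<close>
  obtain t where t_mem: "\<And>i. i \<in> I \<Longrightarrow> t i \<in> I \<times> H"
    and t_fib: "\<And>a h. a \<in> I \<Longrightarrow> h \<in> H \<Longrightarrow> \<not> countable {i \<in> I. t i = (a, h)}"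
  proof (rule enumeration_with_uncountable_fibres[OF I HI H])
    fix t :: "'i \<Rightarrow> 'i \<times> real set \<times> nat"
    assume "\<And>i. i \<in> I \<Longrightarrow> t i \<in> I \<times> H"
      "\<And>a h. a \<in> I \<Longrightarrow> h \<in> H \<Longrightarrow> \<not> countable {i \<in> I. t i = (a, h)}"
    then show thesis by (rule that)
  qed
  define R where "R = |I| - Id"
  have wo: "Well_order |I|" by (rule card_of_Well_order)
  have wfR: "wf R" using wo unfolding R_def well_order_on_def by blast
  have lin: "Linear_order |I|" using wo unfolding well_order_on_def by blast
  have transR: "trans R"
    using lin unfolding R_def linear_order_on_def partial_order_on_def preorder_on_def
    by (blast intro: trans_diff_Id)
  have totR: "total_on I R"
    using lin unfolding R_def linear_order_on_def Field_card_of by (auto simp: total_on_def)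
  have RI: "R \<subseteq> I \<times> I"
    using Field_card_of[of I] unfolding R_def Field_def by auto
  define below where "below i = {l. (l, i) \<in> R}" for i
  have "below i = underS |I| i" for i by (auto simp: below_def R_def underS_def)
  then have cnt: "countable (below i)" for i using countable_underS_omega1[OF I] by simp
  \<comment> \<open>For \<open>fst (t i) > i\<close> the intersection turns stage \<open>i\<close> into a harmless one.\<close>
  define C where "C i = below i \<inter> below (fst (t i))" for i
  define h where "h i = g (snd (t i))" for i
  obtain f :: "'i \<Rightarrow> nat \<times> nat \<Rightarrow> bool"
    where f_guided: "\<And>i s. i \<in> I \<Longrightarrow> f i s \<Longrightarrow> s \<in> guided (C i) (h i) f"
      and f_indep: "\<And>G p n. finite G \<Longrightarrow> G \<subseteq> I \<Longrightarrow> infinite (layer f G p n)"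
  proof (rule guided_independent_family[OF wfR transR totR RI])
    show "countable {l. (l, i) \<in> R}" for i using cnt[of i] by (simp add: below_def)
    show "C i \<subseteq> {l. (l, i) \<in> R}" for i by (auto simp: C_def below_def)
    show "strict_mono (snd (h i))" if "i \<in> I" for i
      using g_mono t_mem[OF that] unfolding h_def H_def by (metis mem_Times_iff)
    fix f :: "'i \<Rightarrow> nat \<times> nat \<Rightarrow> bool"
    assume "\<And>i s. i \<in> I \<Longrightarrow> f i s \<Longrightarrow> s \<in> guided (C i) (h i) f"
      "\<And>G p n. finite G \<Longrightarrow> G \<subseteq> I \<Longrightarrow> infinite (layer f G p n)"
    then show thesis by (rule that)
  qed
  define X where "X s = restrict (\<lambda>i. f i s) I" for s
  define S where "S = range X"
  define D where "D n = X ` {s. fst s = n}" for n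
  have S: "S \<subseteq> extensional I" by (auto simp: S_def X_def)
  have D: "D n \<subseteq> S" for n by (auto simp: D_def S_def)
  have D_meets: "\<exists>d\<in>D n. agree_on G d p" if G: "finite G" "G \<subseteq> I" for n G p
  proof -
    obtain s where s: "s \<in> layer f G p n"
      using f_indep[OF G, of p n] by (metis ex_in_conv infinite_imp_nonempty)
    then have "agree_on G (X s) p" using G(2) by (auto simp: layer_def agree_on_def X_def)
    moreover have "X s \<in> D n" using s by (simp add: D_def layer_def)
    ultimately show ?thesis by blast
  qed
  have S_meets: "\<exists>d\<in>S. agree_on G d p" if "finite G" "G \<subseteq> I" for G p
    using D_meets[OF that, of 0 p] D by blast
  have whole: "subtopology (cantor_cube I) (extensional I) = cantor_cube I"
    by (metis subtopology_topspace topspace_cantor_cube)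
  have "dense_in (cantor_cube I) S"
    using dense_in_subtopology_cantor_cube[of "extensional I" I S] S S_meets unfolding whole by simp
  moreover have "countable S" by (simp add: S_def)
  moreover have "\<not> NWD_separable (subtopology (cantor_cube I) S)" (is "\<not> NWD_separable ?Y")
  proof
    assume "NWD_separable ?Y"
    moreover have "dense_in ?Y (D n)" for n
      unfolding dense_in_subtopology_cantor_cube[OF S] using D D_meets by simp
    ultimately obtain E where E: "\<And>n. E n \<subseteq> D n" "\<And>n. nowhere_dense_in ?Y (E n)"
      and dense: "dense_in ?Y (\<Union>n. E n)"
      unfolding NWD_separable_def by metis
    have "cyl_nowhere_dense I (E n)" for n
      by (rule cyl_nowhere_dense_if_nowhere_dense_in[OF S S_meets E(2)])
    then obtain K where K: "countable K" "K \<subseteq> I" "\<And>n. cyl_nowhere_dense K (E n)"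
      using cyl_nowhere_dense_countable_support[of I E] by metis
    \<comment> \<open>Countably many countable initial segments do not exhaust \<open>I\<close>, so
      some \<open>a\<close> lies above the whole support \<open>K\<close>.\<close>
    have cU: "countable (\<Union>c\<in>K. insert c (below c))" using K(1) cnt by simp
    have "\<not> I \<subseteq> (\<Union>c\<in>K. insert c (below c))"
      using countable_subset[OF _ cU] unc by (rule contrapos_nn[rotated])
    then obtain a where a: "a \<in> I" "a \<notin> (\<Union>c\<in>K. insert c (below c))" by blast
    have K_below: "K \<subseteq> below a"
    proof
      fix c assume c: "c \<in> K"
      then have "c \<noteq> a" "(a, c) \<notin> R" using a(2) by (auto simp: below_def)
      then have "(c, a) \<in> R" using totR a(1) c K(2) unfolding total_on_def by blast
      then show "c \<in> below a" by (simp add: below_def)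
    qed
    \<comment> \<open>The numbering of \<open>below a\<close> that \<open>guided\<close> uses at any
      stage \<open>b\<close> with \<open>C b = below a\<close>.\<close>
    let ?e = "to_nat_on (below a)"
    have inj: "inj_on ?e (below a)" by (rule inj_on_to_nat_on[OF cnt])
    have "cyl_nowhere_dense UNIV {y. \<exists>z\<in>E n. \<forall>i\<in>below a. y (?e i) = z i}" for n
      by (rule cyl_nowhere_dense_reindex[OF cyl_nowhere_dense_mono[OF K(3) K_below] inj])
    then obtain p where p: "p \<in> H"
      "captures (g p) (\<lambda>n. {y. \<exists>z\<in>E n. \<forall>i\<in>below a. y (?e i) = z i})"
      using g_cap[of "\<lambda>n. {y. \<exists>z\<in>E n. \<forall>i\<in>below a. y (?e i) = z i}"] unfolding H_def by blast
    \<comment> \<open>An uncountable fibre does not fit into \<open>below a\<close>, so the guess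
      \<open>(a, p)\<close> is made at some stage \<open>b\<close> not before
      \<open>a\<close>.\<close>
    have "\<not> {i \<in> I. t i = (a, p)} \<subseteq> below a"
      using countable_subset[OF _ cnt] t_fib[OF a(1) p(1)] by (rule contrapos_nn[rotated])
    then obtain b where b: "b \<in> I" "t b = (a, p)" "b \<notin> below a" by blast
    have "below a \<subseteq> below b"
    proof (cases "a = b")
      case False
      then have "(a, b) \<in> R" using totR a(1) b(1,3) unfolding total_on_def below_def by blast
      then show ?thesis using transR unfolding below_def trans_def by blast
    qed simp
    then have Cb: "C b = below a" using b(2) by (auto simp: C_def)
    have hb: "h b = g p" using b(2) by (simp add: h_def)
    \<comment> \<open>The open set of points true at \<open>b\<close> is nonempty, so the dense
      union meets it in some \<open>z\<close> of some \<open>E n\<close>. Truth at \<open>b\<close>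
      makes \<open>z\<close> agree with the guide on a block of index at least \<open>n\<close>,
      which capture forbids.\<close>
    obtain d where d: "d \<in> S" "agree_on {b} d (\<lambda>_. True)" using S_meets[of "{b}"] b(1) by blast
    have "\<exists>z\<in>\<Union>n. E n. agree_on {b} z d"
      using dense d(1) b(1) unfolding dense_in_subtopology_cantor_cube[OF S] by simp
    then obtain z n where zn: "z \<in> E n" and z: "agree_on {b} z d" by auto
    then obtain s where s: "fst s = n" "z = X s" using E(1)[of n] by (auto simp: D_def)
    have "f b s" using z d(2) b(1) s(2) by (simp add: agree_on_def X_def)
    then have "s \<in> guided (below a) (g p) f" using f_guided[OF b(1)] Cb hb by simp
    then obtain k where k: "n \<le> k"
      "agree_on (block (below a) (snd (g p)) k) (\<lambda>i. f i s) (\<lambda>i. fst (g p) (?e i))"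
      unfolding guided_def s(1)[symmetric] by blast
    obtain i where i: "i \<in> below a" "?e i \<in> {snd (g p) k..<snd (g p) (Suc k)}" "z i \<noteq> fst (g p) (?e i)"
      using not_guided_if_captured[OF inj p(2) zn k(1)] by blast
    have "i \<in> I" using i(1) RI by (auto simp: below_def)
    moreover have "i \<in> block (below a) (snd (g p)) k" using i(1,2) unfolding block_def by blast
    ultimately show False using k(2) i(3) s(2) by (simp add: agree_on_def X_def)
  qed
  ultimately show ?thesis by blast
qed

theorem theorem4p11:
  fixes I :: "'i set"
  assumes "ordIso2 (card_of I) omega1"
    and "cof_meager_eq_omega1"
  shows "(\<exists>S. dense_in (cantor_cube I) S \<and> countable S \<and>
              \<not> NWD_separable (subtopology (cantor_cube I) S))
         \<and> cds_eq_omega1"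
proof
  show "\<exists>S. dense_in (cantor_cube I) S \<and> countable S \<and>
              \<not> NWD_separable (subtopology (cantor_cube I) S)"
    by (rule dense_subspace_not_NWD_separable[OF assms])
  \<comment> \<open>\<open>Field omega1\<close> is a set of sets of naturals, hence an index set of
    the type over which \<open>cds_eq_omega1\<close> quantifies.\<close>
  define J where "J = Field omega1"
  have J: "|J| =o omega1"
    unfolding J_def by (intro card_of_Field_ordIso cardSuc_Card_order natLeq_Card_order)
  have infJ: "infinite J" using uncountable_if_card_omega1[OF J] by (auto intro: countable_finite)
  obtain S where S: "dense_in (cantor_cube J) S" "countable S"
    "\<not> NWD_separable (subtopology (cantor_cube J) S)"
    using dense_subspace_not_NWD_separable[OF J assms(2)] by blast
  have "has_countable_nonD_subspace J"
    unfolding has_countable_nonD_subspace_def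
    using S not_D_separable_if_not_NWD_separable[OF infJ S(1,3)] unfolding dense_in_def by blast
  \<comment> \<open>An index set smaller than \<open>omega1\<close> is countable, and all subspaces
    of its cube are then D-separable.\<close>
  moreover have "omega1 \<le>o |A|" if A: "has_countable_nonD_subspace A" for A :: "nat set set"
  proof (rule ccontr)
    assume "\<not> omega1 \<le>o |A|"
    then have "|A| <o omega1"
      by (metis card_of_Well_order cardSuc_Card_order card_order_on_well_order_on natLeq_Card_order
          not_ordLeq_iff_ordLess)
    then have "countable A"
      using ordLess_omega1_iff_countable[OF card_of_Card_order] countable_card_le_natLeq by blast
    then show False
      using A D_separable_countable_cube[of A] unfolding has_countable_nonD_subspace_def
        topspace_cantor_cube by blast
  qed
  ultimately show "cds_eq_omega1" unfolding cds_eq_omega1_def using J by blast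
qed

end
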